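(* Let $T>0$ and let $\rho_0\in\mathcal{M}^{+}([0,1))$ and $\mu\in\mathcal{M}^{+}((0,T])$ be Borel measures whose singular continuous parts are zero. Then there exists a unique Lagrangian solution $\rho\colon[0,T]\to\mathcal{M}^{+}([0,1))$, $t\mapsto\rho_t=\Phi_t(\rho_0,\mu)$, with initial datum $\rho_0$ and influx $\mu$.
   Context: For an interval $I\subseteq\mathbb{R}$, $\mathcal{M}^{+}(I)$ denotes the set of nonnegative finite Borel measures on $I$. The velocity $\alpha\colon[0,\infty)\to(0,1]$ is a fixed strictly decreasing, Lipschitz continuous function with $\alpha(0)=1$. Semiflow: for $v\colon[0,T]\times[0,\infty)\to(0,1]$ integrable in the first variable and constant in the second variable, the semiflow of $v$ is the map $X\colon\{(t,r)\colon 0\le r\le t\le T\}\times[0,\infty)\to[0,\infty)$ such that for all $r\in[0,T]$ and $x_0\in[0,\infty)$: $X(r;r,x_0)=x_0$, $t\mapsto X(t;r,x_0)$ is absolutely continuous on $[r,T]$, and $\frac{\partial}{\partial t}X(t;r,x_0)=v(t,X(t;r,x_0))$ for almost every $t\in[r,T]$. Lagrangian solution: a function $\rho\colon[0,T]\to\mathcal{M}^{+}([0,1))$ is a Lagrangian solution with initial datum $\rho_0$ and influx $\mu$ if for every $t\in[0,T]$ and every Borel set $E\subseteq[0,1)$ $$\rho_t(E)=\int_{[0,1)}\chi_E(X(t;0,x_0))\,d\rho_0(x_0)+\int_{(0,t]}\chi_E(X(t;s,0))\,d\mu(s),$$ where $\chi_E$ is the indicator function of $E$ and $X$ is the semiflow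 of the vector field $v(t,x)=\alpha(W(t))$, $W(t)=\rho_t([0,1))$ (with $W$ measurable). It is the Lagrangian reading of the conservation law $\partial_t\rho+\partial_x(\alpha(W(t))\rho)=0$ on $[0,1)$. *)

theory Defs
  imports "HOL-Analysis.Analysis"
begin

definition Mplus :: "real set \<Rightarrow> real measure set" where
  "Mplus I = {M. sets M = sets (restrict_space borel I) \<and> finite_measure M}"

text \<open>
  Lebesgue decomposition of a measure on \<open>I\<close> with respect to Lebesgue measure, into an absolutely
  continuous part \<open>a\<close>, a singular continuous part \<open>s\<close> (no atoms, concentrated on a Lebesgue null
  set) and a pure point part \<open>p\<close> (concentrated on a countable set).
\<close>

definition lebesgue_decomposition ::
  "real set \<Rightarrow> real measure \<Rightarrow> real measure \<Rightarrow> real measure \<Rightarrow> real measure \<Rightarrow> bool" where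
  "lebesgue_decomposition I M a s p \<longleftrightarrow>
     a \<in> Mplus I \<and> s \<in> Mplus I \<and> p \<in> Mplus I \<and>
     (\<forall>A\<in>sets M. emeasure M A = emeasure a A + emeasure s A + emeasure p A) \<and>
     absolutely_continuous (restrict_space lborel I) a \<and>
     (\<exists>N\<in>null_sets (restrict_space lborel I). emeasure s (I - N) = 0) \<and>
     (\<forall>x\<in>I. emeasure s {x} = 0) \<and>
     (\<exists>C. countable C \<and> C \<subseteq> I \<and> emeasure p (I - C) = 0)"

definition zero_singular_continuous_part :: "real set \<Rightarrow> real measure \<Rightarrow> bool" where
  "zero_singular_continuous_part I M \<longleftrightarrow>
     (\<exists>a s p. lebesgue_decomposition I M a s p \<and> emeasure s I = 0)"

text \<open>The singular continuous part is unique, so the existential quantifier above is harmless.\<close>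

lemma singular_continuous_part_unique:
  assumes I: "I \<in> sets borel" and M: "M \<in> Mplus I"
    and d: "lebesgue_decomposition I M a s p" and d': "lebesgue_decomposition I M a' s' p'"
  shows "s = s'"
proof -
  have sM: "sets M = sets (restrict_space borel I)" using M by (simp add: Mplus_def)
  have sL: "sets (restrict_space lborel I) = sets M"
    using sM by (simp add: sets_restrict_space)
  have II: "I \<in> sets M" using sM I by (auto simp: sets_restrict_space)
  have countM: "X \<in> sets M" if "countable X" "X \<subseteq> I" for X
  proof -
    have "X \<in> sets borel"
      by (rule sets.countable[OF _ that(1)]) (simp add: borel_closed)
    moreover have "X = I \<inter> X" using that(2) by blast
    ultimately show ?thesis unfolding sM sets_restrict_space by (rule rev_image_eqI)
  qed
  have key: "emeasure s A = emeasure M (A \<inter> N' - C')"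
    if d: "lebesgue_decomposition I M a s p"
      and N: "N \<in> null_sets (restrict_space lborel I)" "emeasure s (I - N) = 0"
      and C: "C \<subseteq> I" "emeasure p (I - C) = 0" "countable C"
      and N': "N' \<in> null_sets (restrict_space lborel I)" "N \<subseteq> N'"
      and C': "countable C'" "C' \<subseteq> I" "C \<subseteq> C'"
      and A: "A \<in> sets M" for a s p N C N' C' A
  proof -
    have sa: "sets a = sets M" and ss: "sets s = sets M" and sp: "sets p = sets M"
      using d sM by (auto simp: lebesgue_decomposition_def Mplus_def)
    have AI: "A \<subseteq> I" using A sM I by (auto simp: sets_restrict_space)
    have NM: "N \<in> sets M" "N' \<in> sets M" using N N' sL by auto
    have CM: "C' \<in> sets M" "C \<in> sets M" using countM C' C by auto
    let ?B = "A \<inter> N' - C'"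
    have B: "?B \<in> sets M" using A NM CM by auto
    have "?B \<in> null_sets (restrict_space lborel I)"
      by (rule null_sets_subset[OF N'(1)]) (use B sL in auto)
    then have a0: "emeasure a ?B = 0"
      using d[unfolded lebesgue_decomposition_def absolutely_continuous_def] by (meson null_setsD1 subsetD)
    have p0: "emeasure p ?B = 0"
      by (rule emeasure_eq_0[OF _ C(2)]) (use sp II CM AI C' in auto)
    have ssing: "\<forall>x\<in>C'. {x} \<in> sets s \<and> emeasure s {x} = 0"
    proof
      fix x assume "x \<in> C'"
      then have "x \<in> I" using C'(2) by blast
      moreover have "{x} \<in> sets s" using countM[of "{x}"] \<open>x \<in> I\<close> ss by simp
      moreover have "\<forall>x\<in>I. emeasure s {x} = 0" using d unfolding lebesgue_decomposition_def by (elim conjE)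
      ultimately show "{x} \<in> sets s \<and> emeasure s {x} = 0" by blast
    qed
    have "(\<Union>x\<in>C'. {x}) \<in> null_sets s"
      by (rule null_sets_UN'[OF C'(1)]) (use ssing in auto)
    then have sC: "C' \<in> null_sets s" by simp
    have "I - N \<in> null_sets s" using N ss II NM by auto
    then have Un: "(I - N) \<union> C' \<in> null_sets s" using sC by (rule null_sets.Un)
    have "emeasure s A = emeasure s (A - ((I - N) \<union> C'))"
      by (rule emeasure_Diff_null_set[symmetric]) (use Un A ss in auto)
    also have "\<dots> = emeasure s (?B - ((I - N) \<union> C'))"
      by (rule arg_cong[where f = "emeasure s"]) (use AI N' in auto)
    also have "\<dots> = emeasure s ?B"
      by (rule emeasure_Diff_null_set) (use Un B ss in auto)
    also have "\<dots> = emeasure M ?B"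
      using d B a0 p0 by (simp add: lebesgue_decomposition_def)
    finally show ?thesis .
  qed
  obtain N where N: "N \<in> null_sets (restrict_space lborel I)" "emeasure s (I - N) = 0"
    using d[unfolded lebesgue_decomposition_def] by (elim conjE bexE exE)
  obtain C where C: "C \<subseteq> I" "emeasure p (I - C) = 0" "countable C"
    using d[unfolded lebesgue_decomposition_def] by (elim conjE bexE exE)
  obtain N' where N': "N' \<in> null_sets (restrict_space lborel I)" "emeasure s' (I - N') = 0"
    using d'[unfolded lebesgue_decomposition_def] by (elim conjE bexE exE)
  obtain C' where C': "C' \<subseteq> I" "emeasure p' (I - C') = 0" "countable C'"
    using d'[unfolded lebesgue_decomposition_def] by (elim conjE bexE exE)
  have NN: "N \<union> N' \<in> null_sets (restrict_space lborel I)" using N(1) N'(1) by (rule null_sets.Un)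
  have CC: "countable (C \<union> C')" "C \<union> C' \<subseteq> I" using C C' by auto
  show ?thesis
  proof (rule measure_eqI)
    show "sets s = sets s'"
      using d d' by (simp add: lebesgue_decomposition_def Mplus_def)
    fix A assume "A \<in> sets s"
    then have A: "A \<in> sets M" using d sM by (simp add: lebesgue_decomposition_def Mplus_def)
    show "emeasure s A = emeasure s' A"
      using key[OF d N C NN _ CC _ A] key[OF d' N' C' NN _ CC _ A] by simp
  qed
qed

definition absolutely_continuous_fun_on :: "real \<Rightarrow> real \<Rightarrow> (real \<Rightarrow> real) \<Rightarrow> bool" where
  "absolutely_continuous_fun_on a b f \<longleftrightarrow>
     (\<forall>\<epsilon>>0. \<exists>\<delta>>0. \<forall>(n::nat) (l::nat \<Rightarrow> real) (u::nat \<Rightarrow> real).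
        (\<forall>i<n. a \<le> l i \<and> l i < u i \<and> u i \<le> b) \<longrightarrow>
        disjoint_family_on (\<lambda>i. {l i<..<u i}) {..<n} \<longrightarrow>
        (\<Sum>i<n. u i - l i) < \<delta> \<longrightarrow>
        (\<Sum>i<n. \<bar>f (u i) - f (l i)\<bar>) < \<epsilon>)"

definition velocity_field :: "real \<Rightarrow> (real \<Rightarrow> real \<Rightarrow> real) \<Rightarrow> bool" where
  "velocity_field T v \<longleftrightarrow>
     (\<forall>t\<in>{0..T}. \<forall>x\<ge>0. v t x \<in> {0<..1}) \<and>
     (\<forall>x\<ge>0. integrable (lebesgue_on {0..T}) (\<lambda>t. v t x)) \<and>
     (\<forall>t\<in>{0..T}. \<forall>x\<ge>0. \<forall>y\<ge>0. v t x = v t y)"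

text \<open>\<open>X t r x\<close> stands for $X(t; r, x)$ and is only constrained for \<open>0 \<le> r \<le> t \<le> T\<close> and \<open>x \<ge> 0\<close>.\<close>

definition is_semiflow ::
  "real \<Rightarrow> (real \<Rightarrow> real \<Rightarrow> real) \<Rightarrow> (real \<Rightarrow> real \<Rightarrow> real \<Rightarrow> real) \<Rightarrow> bool" where
  "is_semiflow T v X \<longleftrightarrow>
     velocity_field T v \<and>
     (\<forall>r\<in>{0..T}. \<forall>t\<in>{r..T}. \<forall>x\<ge>0. X t r x \<ge> 0) \<and>
     (\<forall>r\<in>{0..T}. \<forall>x\<ge>0.
        X r r x = x \<and>
        absolutely_continuous_fun_on r T (\<lambda>t. X t r x) \<and>
        (AE t in lebesgue_on {r..T}.
           ((\<lambda>t'. X t' r x) has_real_derivative v t (X t r x)) (at t within {r..T})))"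

definition lagrangian_solution ::
  "(real \<Rightarrow> real) \<Rightarrow> real \<Rightarrow> real measure \<Rightarrow> real measure \<Rightarrow> (real \<Rightarrow> real measure) \<Rightarrow> bool" where
  "lagrangian_solution \<alpha> T \<rho>\<^sub>0 \<mu> \<rho> \<longleftrightarrow>
     \<rho> \<in> {0..T} \<rightarrow> Mplus {0..<1} \<and>
     (let W = (\<lambda>t. measure (\<rho> t) {0..<1}) in
        W \<in> borel_measurable (lebesgue_on {0..T}) \<and>
        (\<exists>X. is_semiflow T (\<lambda>t x. \<alpha> (W t)) X \<and>
           (\<forall>t\<in>{0..T}. \<forall>E\<in>sets (restrict_space borel {0..<1}).
              emeasure (\<rho> t) E =
                (\<integral>\<^sup>+x. indicator E (X t 0 x) \<partial>\<rho>\<^sub>0) +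
                (\<integral>\<^sup>+s\<in>{0<..t}. indicator E (X t s 0) \<partial>\<mu>))))"

end

theory Submission
  imports Defs
begin

text \<open>The velocity does not depend on the position, so the semiflow is \<open>X t s x = x + \<xi> t - \<xi> s\<close> for
  a single increasing front \<open>\<xi>\<close>, and the load \<open>W\<close> is a functional of \<open>\<xi>\<close>. Lagrangian solutions thus
  correspond to solutions of \<open>\<xi> t = \<integral>\<^sub>0\<^sup>t \<alpha> (W s) ds\<close>. Influx remains in \<open>[0,1)\<close> for at least one unit
  of time, because the velocity is at most 1. If \<open>\<xi>\<close> is known up to time \<open>n\<close>, then up to time \<open>n + 1\<close> the
  load is therefore a nonincreasing function of the current value of \<open>\<xi>\<close>, and the right-hand side is a
  monotone operator, which has a fixed point by Tarski's argument. For uniqueness the velocity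
  is bounded below by a positive constant, so that two fronts at distance \<open>D\<close> are time shifts of each
  other up to \<open>O(D)\<close>; integrating the difference of the loads over a short interval gives \<open>O(D)\<close> times
  the variation of the load, which is small by right continuity.\<close>

section \<open>Integration on the real line\<close>

lemma absolutely_continuous_fun_on_subinterval:
  assumes ac: "absolutely_continuous_fun_on a b F" and "a \<le> c" "d \<le> b"
  shows "absolutely_continuous_fun_on c d F"
  unfolding absolutely_continuous_fun_on_def
proof (intro allI impI)
  fix \<epsilon> :: real assume "\<epsilon> > 0"
  then obtain \<delta> where "\<delta> > 0" and \<delta>: "\<And>(n::nat) l u. (\<forall>i<n. a \<le> l i \<and> l i < u i \<and> u i \<le> b) \<Longrightarrow>
    disjoint_family_on (\<lambda>i. {l i<..<u i}) {..<n} \<Longrightarrow> (\<Sum>i<n. u i - l i) < \<delta> \<Longrightarrow>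
    (\<Sum>i<n. \<bar>F (u i) - F (l i)\<bar>) < \<epsilon>"
    using ac[unfolded absolutely_continuous_fun_on_def, rule_format, of \<epsilon>] by blast
  have "(\<Sum>i<n. \<bar>F (u i) - F (l i)\<bar>) < \<epsilon>"
    if "\<forall>i<n. c \<le> l i \<and> l i < u i \<and> u i \<le> d" "disjoint_family_on (\<lambda>i. {l i<..<u i}) {..<n}"
      "(\<Sum>i<n. u i - l i) < \<delta>" for n :: nat and l u
    using that assms(2,3) by (intro \<delta>) force+
  then show "\<exists>\<delta>>0. \<forall>(n::nat) l u. (\<forall>i<n. c \<le> l i \<and> l i < u i \<and> u i \<le> d) \<longrightarrow>
    disjoint_family_on (\<lambda>i. {l i<..<u i}) {..<n} \<longrightarrow> (\<Sum>i<n. u i - l i) < \<delta> \<longrightarrow>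
    (\<Sum>i<n. \<bar>F (u i) - F (l i)\<bar>) < \<epsilon>"
    using \<open>\<delta> > 0\<close> by blast
qed

text \<open>Enumerating \<open>Q\<close> by \<open>{..<card Q}\<close> frees the condition from
  numbered intervals, so that it applies to the pieces of a tagged division, which come as a finite
  set.\<close>

lemma absolutely_continuous_fun_on_finite_family:
  assumes "absolutely_continuous_fun_on a b F" "\<epsilon> > 0"
  obtains \<delta> where "\<delta> > 0"
    "\<And>(Q::'i set) l u. finite Q \<Longrightarrow> (\<And>i. i \<in> Q \<Longrightarrow> a \<le> l i \<and> l i < u i \<and> u i \<le> b) \<Longrightarrow>
       disjoint_family_on (\<lambda>i. {l i<..<u i}) Q \<Longrightarrow> (\<Sum>i\<in>Q. u i - l i) < \<delta> \<Longrightarrow>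
       (\<Sum>i\<in>Q. \<bar>F (u i) - F (l i)\<bar>) < \<epsilon>"
proof -
  obtain \<delta> where "\<delta> > 0" and \<delta>: "\<And>(n::nat) (l::nat \<Rightarrow> real) u.
        (\<forall>i<n. a \<le> l i \<and> l i < u i \<and> u i \<le> b) \<Longrightarrow>
        disjoint_family_on (\<lambda>i. {l i<..<u i}) {..<n} \<Longrightarrow>
        (\<Sum>i<n. u i - l i) < \<delta> \<Longrightarrow> (\<Sum>i<n. \<bar>F (u i) - F (l i)\<bar>) < \<epsilon>"
    using assms(1)[unfolded absolutely_continuous_fun_on_def, rule_format, OF assms(2)] by blast
  show thesis
  proof (rule that[OF \<open>\<delta> > 0\<close>])
    fix Q :: "'i set" and l u
    assume Q: "finite Q" "\<And>i. i \<in> Q \<Longrightarrow> a \<le> l i \<and> l i < u i \<and> u i \<le> b"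
       "disjoint_family_on (\<lambda>i. {l i<..<u i}) Q" "(\<Sum>i\<in>Q. u i - l i) < \<delta>"
    obtain k where k: "bij_betw k {..<card Q} Q"
      using ex_bij_betw_nat_finite[OF Q(1)] by (auto simp: atLeast0LessThan)
    have "(\<Sum>i<card Q. \<bar>F (u (k i)) - F (l (k i))\<bar>) < \<epsilon>"
    proof (rule \<delta>)
      show "\<forall>i<card Q. a \<le> l (k i) \<and> l (k i) < u (k i) \<and> u (k i) \<le> b"
        using Q(2) bij_betwE[OF k] by auto
      show "disjoint_family_on (\<lambda>i. {l (k i)<..<u (k i)}) {..<card Q}"
        unfolding disjoint_family_on_def
      proof (intro ballI impI)
        fix i j assume "i \<in> {..<card Q}" "j \<in> {..<card Q}" "i \<noteq> j"
        then have "k i \<in> Q" "k j \<in> Q" "k i \<noteq> k j"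
          using k by (auto simp: bij_betw_def inj_on_def)
        then show "{l (k i)<..<u (k i)} \<inter> {l (k j)<..<u (k j)} = {}"
          using Q(3) unfolding disjoint_family_on_def by blast
      qed
      show "(\<Sum>i<card Q. u (k i) - l (k i)) < \<delta>"
        using Q(4) sum.reindex_bij_betw[OF k, of "\<lambda>i. u i - l i"] by simp
    qed
    then show "(\<Sum>i\<in>Q. \<bar>F (u i) - F (l i)\<bar>) < \<epsilon>"
      using sum.reindex_bij_betw[OF k, of "\<lambda>i. \<bar>F (u i) - F (l i)\<bar>"] by simp
  qed
qed

text \<open>Tags outside \<open>N\<close> are controlled by differentiability. The pieces tagged in
  \<open>N\<close> lie in an open set of small measure, where absolute continuity bounds the total
  increment of \<open>F\<close>.\<close>

lemma fundamental_theorem_of_calculus_absolutely_continuous: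
  fixes F f :: "real \<Rightarrow> real"
  assumes "a \<le> b" and ac: "absolutely_continuous_fun_on a b F" and N: "negligible N"
    and der: "\<And>x. x \<in> {a..b} - N \<Longrightarrow> (F has_real_derivative f x) (at x within {a..b})"
  shows "(f has_integral (F b - F a)) {a..b}"
proof -
  \<comment> \<open>Setting the integrand to zero on \<open>N\<close> removes the tags in
    \<open>N\<close> from the Riemann sums; as \<open>N\<close> is negligible, the integral is that
    of \<open>f\<close>.\<close>
  define g where "g x = (if x \<in> N then 0 else f x)" for x
  have "(g has_integral (F b - F a)) {a..b}"
    unfolding has_integral_real
  proof safe
    fix e0 :: real assume "e0 > 0"
    \<comment> \<open>The two groups of tags get \<open>e0 / 2\<close> each; the summand 1 keeps the
      denominator positive when \<open>a = b\<close>.\<close>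
    define e where "e = e0 / (2 * (b - a + 1))"
    have "e > 0" using \<open>e0 > 0\<close> \<open>a \<le> b\<close> by (simp add: e_def)
    have e_le: "e * (b - a) \<le> e0 / 2"
      using \<open>e0 > 0\<close> \<open>a \<le> b\<close> by (simp add: e_def field_simps)
    have "\<forall>x. \<exists>d>0. x \<in> {a..b} - N \<longrightarrow>
         (\<forall>y\<in>{a..b}. norm (y-x) < d \<longrightarrow> norm (F y - F x - (y-x) *\<^sub>R f x) \<le> e * norm (y-x))"
      using der[unfolded has_real_derivative_iff_has_vector_derivative has_vector_derivative_def
          has_derivative_within_alt] \<open>e > 0\<close> by (metis gt_ex)
    then obtain d where d: "\<And>x. 0 < d x"
      "\<And>x y. \<lbrakk>x \<in> {a..b} - N; y \<in> {a..b}; norm (y-x) < d x\<rbrakk>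
                        \<Longrightarrow> norm (F y - F x - (y-x) *\<^sub>R f x) \<le> e * norm (y-x)"
      by metis
    from \<open>e0 > 0\<close> have "e0 / 2 > 0" by simp
    obtain \<delta> where "\<delta> > 0" and \<delta>: "\<And>(Q::(real \<times> real set) set) l u. finite Q \<Longrightarrow>
       (\<And>i. i \<in> Q \<Longrightarrow> a \<le> l i \<and> l i < u i \<and> u i \<le> b) \<Longrightarrow>
       disjoint_family_on (\<lambda>i. {l i<..<u i}) Q \<Longrightarrow> (\<Sum>i\<in>Q. u i - l i) < \<delta> \<Longrightarrow>
       (\<Sum>i\<in>Q. \<bar>F (u i) - F (l i)\<bar>) < e0 / 2"
      by (rule absolutely_continuous_fun_on_finite_family[OF ac \<open>e0 / 2 > 0\<close>]) blast
    have Nleb: "N \<in> sets lebesgue" using N by (simp add: negligible_imp_sets)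
    obtain U where U: "open U" "N \<subseteq> U" "U - N \<in> lmeasurable" "emeasure lebesgue (U - N) < ennreal \<delta>"
      using sets_lebesgue_outer_open[OF Nleb \<open>\<delta> > 0\<close>] by metis
    have Nnull: "N \<in> null_sets lebesgue" using N by (simp add: negligible_iff_null_sets)
    have UNU: "U = (U - N) \<union> N" using U(2) by blast
    have Um: "U \<in> lmeasurable"
      by (subst UNU) (intro fmeasurable.Un U(3) negligible_imp_measurable N)
    have Ue: "emeasure lebesgue U < ennreal \<delta>"
      using emeasure_Diff_null_set[OF Nnull, of U] U(4) Um by (simp add: fmeasurableD)
    have U\<delta>: "measure lebesgue U < \<delta>"
      using Ue by (simp add: emeasure_eq_measure2[OF Um] ennreal_less_iff)
    define \<gamma> where "\<gamma> x = (if x \<in> N then U else ball x (d x))" for x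
    show "\<exists>\<gamma>. gauge \<gamma> \<and> (\<forall>\<D>. \<D> tagged_division_of {a..b} \<and> \<gamma> fine \<D> \<longrightarrow>
        norm ((\<Sum>(x,k)\<in>\<D>. measure lborel k *\<^sub>R g x) - (F b - F a)) < e0)"
    proof (rule exI[of _ \<gamma>], safe)
      show "gauge \<gamma>"
        using U(1,2) d(1) by (auto simp: gauge_def \<gamma>_def)
      fix p assume p: "p tagged_division_of {a..b}" and fine: "\<gamma> fine p"
      note p' = tagged_division_ofD[OF p]
      have K: "\<exists>u v. K = {u..v} \<and> u \<le> v \<and> a \<le> u \<and> v \<le> b \<and> x \<in> K" if "(x,K) \<in> p" for x K
        using p'(2,3,4)[OF that] by fastforce
      have ba: "b - a = (\<Sum>(x,K)\<in>p. Sup K - Inf K)" "F b - F a = (\<Sum>(x,K)\<in>p. F (Sup K) - F (Inf K))"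
        using additive_tagged_division_1[where f= "\<lambda>x. x"] additive_tagged_division_1[where f= F]
          \<open>a \<le> b\<close> p by auto
      define p1 where "p1 = {i\<in>p. fst i \<notin> N}"
      define p2 where "p2 = {i\<in>p. fst i \<in> N}"
      \<comment> \<open>Absolute continuity speaks of nondegenerate intervals only; degenerate
        pieces have increment zero.\<close>
      define q where "q = {i\<in>p2. Inf (snd i) < Sup (snd i)}"
      have fin: "finite p" "finite p1" "finite p2" "finite q" using p'(1) by (auto simp: p1_def p2_def q_def)
      have pU: "p = p1 \<union> p2" "p1 \<inter> p2 = {}" by (auto simp: p1_def p2_def)
      have b1: "norm (\<Sum>(x,K)\<in>p1. measure lborel K *\<^sub>R g x - (F (Sup K) - F (Inf K))) \<le>
          (\<Sum>i\<in>p1. e * (case i of (x, K) \<Rightarrow> Sup K - Inf K))"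
      proof (rule sum_norm_le, safe)
        fix x K assume "(x,K) \<in> p1"
        then have xK: "(x,K) \<in> p" "x \<notin> N" by (auto simp: p1_def)
        obtain u v where uv: "K = {u..v}" "u \<le> v" "a \<le> u" "v \<le> b" "x \<in> K" using K[OF xK(1)] by blast
        have ball: "K \<subseteq> ball x (d x)" using fineD[OF fine xK(1)] xK(2) by (simp add: \<gamma>_def)
        have "norm (u - x) < d x" "norm (v - x) < d x"
          using subsetD[OF ball, of u] subsetD[OF ball, of v] uv by (auto simp: dist_real_def)
        then have "norm (F u - F x - (u-x) *\<^sub>R f x) \<le> e * norm (u-x)"
          "norm (F v - F x - (v-x) *\<^sub>R f x) \<le> e * norm (v-x)"
          using uv xK(2) d(2)[of x u] d(2)[of x v] by auto
        moreover have "norm (u - x) = x - u" "norm (v - x) = v - x" using uv by auto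
        moreover have "(v - u) * f x = (v - x) * f x - (u - x) * f x" by (simp add: algebra_simps)
        \<comment> \<open>The tag lies between \<open>u\<close> and \<open>v\<close>, so the errors
          at the two ends add up to exactly this bound.\<close>
        moreover have "e * (v - u) = e * (x - u) + e * (v - x)" by (simp add: algebra_simps)
        ultimately show "norm (measure lborel K *\<^sub>R g x - (F (Sup K) - F (Inf K))) \<le> e * (Sup K - Inf K)"
          using uv xK(2) by (simp add: g_def)
      qed
      also have "\<dots> \<le> (\<Sum>i\<in>p. e * (case i of (x, K) \<Rightarrow> Sup K - Inf K))"
        by (rule sum_mono2[OF fin(1)]) (use K \<open>e > 0\<close> in \<open>force simp: p1_def\<close>)+
      also have "\<dots> = e * (b - a)" by (simp add: ba(1) sum_distrib_left)
      finally have b1': "norm (\<Sum>(x,K)\<in>p1. measure lborel K *\<^sub>R g x - (F (Sup K) - F (Inf K))) \<le> e0 / 2"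
        using e_le by simp
      have disj: "disjoint_family_on (\<lambda>i. {Inf (snd i)<..<Sup (snd i)}) q"
        unfolding disjoint_family_on_def
      proof (intro ballI impI)
        fix i j assume ij: "i \<in> q" "j \<in> q" "i \<noteq> j"
        obtain x K y J where e: "i = (x,K)" "j = (y,J)" by fastforce
        have "(x,K) \<in> p" "(y,J) \<in> p" using ij e by (auto simp: q_def p2_def)
        moreover from this have "interior K \<inter> interior J = {}" using p'(5) ij e by blast
        ultimately show "{Inf (snd i)<..<Sup (snd i)} \<inter> {Inf (snd j)<..<Sup (snd j)} = {}"
          using K[of x K] K[of y J] e by auto
      qed
      have "(\<Sum>i\<in>q. Sup (snd i) - Inf (snd i)) = (\<Sum>i\<in>q. measure lebesgue {Inf (snd i)<..<Sup (snd i)})"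
        by (intro sum.cong) (auto simp: q_def)
      also have "\<dots> = measure lebesgue (\<Union>i\<in>q. {Inf (snd i)<..<Sup (snd i)})"
      proof (rule measure_finite_Union[symmetric, OF fin(4) _ disj])
        show "emeasure lebesgue {Inf (snd i)<..<Sup (snd i)} \<noteq> \<infinity>" if "i \<in> q" for i
          using that by (simp add: q_def)
      qed auto
      also have "\<dots> \<le> measure lebesgue U"
      proof (rule measure_mono_fmeasurable[OF _ _ Um])
        show "(\<Union>i\<in>q. {Inf (snd i)<..<Sup (snd i)}) \<subseteq> U"
        proof (rule UN_least)
          fix i assume "i \<in> q"
          then obtain x K where i: "i = (x,K)" "(x,K) \<in> p" "x \<in> N" by (cases i) (auto simp: q_def p2_def)
          have "K \<subseteq> U" using fineD[OF fine i(2)] i(3) by (simp add: \<gamma>_def)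
          then show "{Inf (snd i)<..<Sup (snd i)} \<subseteq> U" using K[OF i(2)] i by force
        qed
      qed (use fin in auto)
      finally have small: "(\<Sum>i\<in>q. Sup (snd i) - Inf (snd i)) < \<delta>" using U\<delta> by simp
      have b2: "(\<Sum>i\<in>q. \<bar>F (Sup (snd i)) - F (Inf (snd i))\<bar>) < e0 / 2"
      proof (rule \<delta>[OF fin(4) _ disj small])
        fix i assume "i \<in> q"
        then show "a \<le> Inf (snd i) \<and> Inf (snd i) < Sup (snd i) \<and> Sup (snd i) \<le> b"
          using K[of "fst i" "snd i"] by (auto simp: q_def p2_def)
      qed
      have "norm (\<Sum>(x,K)\<in>p2. measure lborel K *\<^sub>R g x - (F (Sup K) - F (Inf K))) \<le>
          (\<Sum>i\<in>p2. \<bar>F (Sup (snd i)) - F (Inf (snd i))\<bar>)"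
        by (rule sum_norm_le) (auto simp: p2_def g_def)
      also have "\<dots> = (\<Sum>i\<in>q. \<bar>F (Sup (snd i)) - F (Inf (snd i))\<bar>)"
      proof (rule sum.mono_neutral_right[OF fin(3)])
        show "\<forall>i\<in>p2 - q. \<bar>F (Sup (snd i)) - F (Inf (snd i))\<bar> = 0"
          using K by (force simp: q_def p2_def)
      qed (auto simp: q_def)
      finally have b2': "norm (\<Sum>(x,K)\<in>p2. measure lborel K *\<^sub>R g x - (F (Sup K) - F (Inf K))) < e0 / 2"
        using b2 by simp
      have "(\<Sum>(x,K)\<in>p. measure lborel K *\<^sub>R g x) - (F b - F a) =
          (\<Sum>(x,K)\<in>p. measure lborel K *\<^sub>R g x - (F (Sup K) - F (Inf K)))"
        by (simp add: ba(2) split_def sum_subtractf)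
      also have "\<dots> = (\<Sum>(x,K)\<in>p1. measure lborel K *\<^sub>R g x - (F (Sup K) - F (Inf K))) +
           (\<Sum>(x,K)\<in>p2. measure lborel K *\<^sub>R g x - (F (Sup K) - F (Inf K)))"
        unfolding pU(1) by (rule sum.union_disjoint) (use fin pU in auto)
      finally show "norm ((\<Sum>(x,K)\<in>p. measure lborel K *\<^sub>R g x) - (F b - F a)) < e0"
        using b1' b2' by (smt (verit, best) norm_triangle_ineq field_sum_of_halves)
    qed
  qed
  then show ?thesis
    by (rule has_integral_spike[OF N, rotated]) (auto simp: g_def)
qed

lemma AE_lebesgue_on_iff_negligible:
  fixes S :: "real set"
  assumes "S \<in> sets lebesgue"
  shows "(AE x in lebesgue_on S. P x) \<longleftrightarrow> negligible {x\<in>S. \<not> P x}"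
proof -
  have "(AE x in lebesgue_on S. P x) \<longleftrightarrow> (AE x in lebesgue. x \<in> S \<longrightarrow> P x)"
    using assms by (intro AE_restrict_space_iff) auto
  also have "\<dots> \<longleftrightarrow> negligible {x\<in>S. \<not> P x}"
    unfolding eventually_ae_filter_negligible by (auto intro: negligible_subset)
  finally show ?thesis .
qed

lemma has_integral_increment:
  fixes g u :: "real \<Rightarrow> real"
  assumes "(g has_integral u s) {a..s}" "(g has_integral u t) {a..t}" "a \<le> s" "s \<le> t"
  shows "(g has_integral (u t - u s)) {s..t}"
proof -
  have "g integrable_on {s..t}"
    using assms by (auto intro: integrable_subinterval_real[of g a t])
  then obtain I where I: "(g has_integral I) {s..t}" by blast
  have "(g has_integral (u s + I)) {a..t}"
    using assms I by (intro has_integral_combine[of a s t]) auto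
  then have "u t = u s + I" using assms(2) has_integral_unique by blast
  then show ?thesis using I by simp
qed

section \<open>Monotone integral equations and shifted integrals\<close>

text \<open>Tarski's argument: the pointwise supremum of all monotone subsolutions
  \<open>u \<le> \<Phi> u\<close> is a fixed point. The bounds on \<open>f\<close> keep the supremum
  finite.\<close>

lemma monotone_integral_equation:
  fixes f :: "real \<Rightarrow> real \<Rightarrow> real"
  assumes mono: "\<And>s y y'. y \<le> y' \<Longrightarrow> f s y \<le> f s y'"
    and f01: "\<And>s y. 0 \<le> f s y" "\<And>s y. f s y \<le> 1"
    and meas: "\<And>u. mono u \<Longrightarrow> (\<lambda>s. f s (u s)) \<in> borel_measurable borel"
  obtains u where "mono u" "\<And>t. 0 \<le> t \<Longrightarrow> ((\<lambda>s. f s (u s)) has_integral u t) {0..t}"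
proof -
  define \<Phi> where "\<Phi> u t = integral {0..t} (\<lambda>s. f s (u s))" for u :: "real \<Rightarrow> real" and t :: real
  have int: "(\<lambda>s. f s (u s)) integrable_on {a..b}" if "mono u" for u :: "real \<Rightarrow> real" and a b
  proof (rule measurable_bounded_by_integrable_imp_integrable_real[where g = "\<lambda>_. 1"])
    show "(\<lambda>s. f s (u s)) \<in> borel_measurable (lebesgue_on {a..b})"
      using meas[OF that] by (intro measurable_restrict_space1) (simp add: measurable_completion)
  qed (use f01 in auto)
  have \<Phi>_mono: "mono (\<Phi> u)" if "mono u" for u
  proof (rule monoI)
    fix s t :: real assume "s \<le> t"
    then show "\<Phi> u s \<le> \<Phi> u t"
      unfolding \<Phi>_def using f01 by (intro integral_subset_le int that) auto
  qed
  have \<Phi>_le: "\<Phi> u t \<le> \<Phi> v t" if "mono u" "mono v" "\<And>s. u s \<le> v s" for u v t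
    unfolding \<Phi>_def using that mono by (intro integral_le int) auto
  have \<Phi>_0: "0 \<le> \<Phi> u t" if "mono u" for u t
    unfolding \<Phi>_def using f01 by (intro integral_nonneg int that) auto
  have \<Phi>_bound: "\<Phi> u t \<le> max 0 t" if "mono u" for u t
  proof -
    have "\<Phi> u t \<le> integral {0..t} (\<lambda>_. 1)"
      unfolding \<Phi>_def using f01 by (intro integral_le int that) auto
    then show ?thesis by (auto split: if_splits)
  qed
  define S where "S = {u. mono u \<and> (\<forall>t. u t \<le> \<Phi> u t)}"
  define U where "U t = (SUP u\<in>S. u t)" for t
  have "mono (\<lambda>_::real. 0::real)" by (simp add: mono_def)
  then have S0: "(\<lambda>_. 0) \<in> S" using \<Phi>_0 by (simp add: S_def)
  have bdd: "bdd_above ((\<lambda>u. u t) ` S)" for t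
    using \<Phi>_bound by (intro bdd_aboveI[of _ "max 0 t"]) (auto simp: S_def intro: order_trans)
  have upper: "u t \<le> U t" if "u \<in> S" for u t
    unfolding U_def by (rule cSUP_upper[OF that bdd])
  have Umono: "mono U"
  proof (rule monoI)
    fix s t :: real assume "s \<le> t"
    show "U s \<le> U t"
      unfolding U_def
    proof (rule cSUP_mono)
      show "\<exists>m\<in>S. u s \<le> m t" if "u \<in> S" for u
        using that \<open>s \<le> t\<close> by (intro bexI[of _ u]) (auto simp: S_def mono_def)
    qed (use S0 bdd in auto)
  qed
  have U_le: "U t \<le> \<Phi> U t" for t
    unfolding U_def[of t]
  proof (rule cSUP_least)
    fix u assume u: "u \<in> S"
    then have "u t \<le> \<Phi> u t" by (simp add: S_def)
    also have "\<dots> \<le> \<Phi> U t" using u upper Umono by (intro \<Phi>_le) (auto simp: S_def)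
    finally show "u t \<le> \<Phi> U t" .
  qed (use S0 in auto)
  \<comment> \<open>Applying the operator to \<open>U \<le> \<Phi> U\<close> shows that
    \<open>\<Phi> U\<close> is itself a subsolution and hence lies below \<open>U\<close>.\<close>
  have "\<Phi> U \<in> S"
    using \<Phi>_mono[OF Umono] \<Phi>_le[OF Umono \<Phi>_mono[OF Umono] U_le] by (simp add: S_def)
  then have eq: "\<Phi> U t = U t" for t using upper U_le by (simp add: antisym)
  show thesis
  proof (rule that[OF Umono])
    show "((\<lambda>s. f s (U s)) has_integral U t) {0..t}" for t
      using integrable_integral[OF int[OF Umono], of 0 t] eq[of t] by (simp add: \<Phi>_def)
  qed
qed

text \<open>Both integrals agree on the common part of the shifted intervals, so only two pieces of length
  \<open>2 * h\<close> survive.\<close>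

lemma integral_shift_difference_antimono:
  fixes g :: "real \<Rightarrow> real"
  assumes "antimono g" "0 \<le> h" "a \<le> t"
    and p: "\<And>x. g x \<le> p" and q: "\<And>x. x \<le> t + h \<Longrightarrow> q \<le> g x"
  shows "(\<lambda>s. g (s - h) - g (s + h)) integrable_on {a..t}"
    and "integral {a..t} (\<lambda>s. g (s - h) - g (s + h)) \<le> 2 * h * (p - q)"
proof -
  have "mono_on {b..c} (\<lambda>x. - g x)" for b c
    using \<open>antimono g\<close> by (auto simp: mono_on_def antimono_def)
  then have "(\<lambda>x. - (- g x)) integrable_on {b..c}" for b c
    by (intro integrable_neg integrable_on_mono_on)
  then have int: "g integrable_on {b..c}" for b c by simp
  have sh: "((\<lambda>s. g (s + k)) has_integral integral {a+k..t+k} g) {a..t}" for k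
    using has_integral_shift_Icc_real[of g k "integral {a+k..t+k} g" a t] integrable_integral[OF int]
    by (simp add: o_def add.commute)
  have sh': "((\<lambda>s. g (s - h)) has_integral integral {a-h..t-h} g) {a..t}"
    using sh[of "-h"] by simp
  have diff: "((\<lambda>s. g (s - h) - g (s + h)) has_integral
      (integral {a-h..t-h} g - integral {a+h..t+h} g)) {a..t}"
    by (rule has_integral_diff[OF sh' sh])
  then show "(\<lambda>s. g (s - h) - g (s + h)) integrable_on {a..t}" by blast
  \<comment> \<open>Two ways to cut the integral over \<open>{a-h..t+h}\<close>. Their comparison
    turns the difference of the shifted integrals into the integral over \<open>{a-h..a+h}\<close>
    minus the one over \<open>{t-h..t+h}\<close>.\<close>
  have c1: "integral {a-h..t-h} g + integral {t-h..t+h} g = integral {a-h..t+h} g"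
    using assms int by (intro Henstock_Kurzweil_Integration.integral_combine) auto
  have c2: "integral {a-h..a+h} g + integral {a+h..t+h} g = integral {a-h..t+h} g"
    using assms int by (intro Henstock_Kurzweil_Integration.integral_combine) auto
  have "integral {a-h..a+h} g \<le> integral {a-h..a+h} (\<lambda>_. p)"
    using p by (intro integral_le int) auto
  then have b1: "integral {a-h..a+h} g \<le> 2 * h * p" using \<open>0 \<le> h\<close> by simp
  have "integral {t-h..t+h} (\<lambda>_. q) \<le> integral {t-h..t+h} g"
    using q by (intro integral_le int) auto
  then have b2: "2 * h * q \<le> integral {t-h..t+h} g" using \<open>0 \<le> h\<close> by simp
  show "integral {a..t} (\<lambda>s. g (s - h) - g (s + h)) \<le> 2 * h * (p - q)"
    using integral_unique[OF diff] c1 c2 b1 b2 by (simp add: algebra_simps)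
qed

section \<open>Fronts\<close>

locale influx_problem =
  fixes \<alpha> :: "real \<Rightarrow> real" and T :: real and \<rho>\<^sub>0 \<mu> :: "real measure" and L :: real
  assumes \<alpha>_range: "\<And>x. 0 \<le> x \<Longrightarrow> 0 < \<alpha> x \<and> \<alpha> x \<le> 1"
    and \<alpha>_antimono: "\<And>x y. 0 \<le> x \<Longrightarrow> x \<le> y \<Longrightarrow> \<alpha> y \<le> \<alpha> x"
    and \<alpha>_lipschitz: "L-lipschitz_on {0..} \<alpha>"
    and T_pos: "0 < T"
    and \<rho>\<^sub>0_Mplus: "\<rho>\<^sub>0 \<in> Mplus {0..<1}"
    and \<mu>_Mplus: "\<mu> \<in> Mplus {0<..T}"
begin

lemma sets_\<rho>\<^sub>0: "A \<in> sets \<rho>\<^sub>0 \<longleftrightarrow> A \<subseteq> {0..<1} \<and> A \<in> sets borel"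
  using \<rho>\<^sub>0_Mplus by (simp add: Mplus_def sets_restrict_space_iff)

lemma sets_\<mu>: "A \<in> sets \<mu> \<longleftrightarrow> A \<subseteq> {0<..T} \<and> A \<in> sets borel"
  using \<mu>_Mplus by (simp add: Mplus_def sets_restrict_space_iff)

lemma space_\<rho>\<^sub>0: "space \<rho>\<^sub>0 = {0..<1}"
  using \<rho>\<^sub>0_Mplus by (auto simp: Mplus_def space_restrict_space dest: sets_eq_imp_space_eq)

lemma space_\<mu>: "space \<mu> = {0<..T}"
  using \<mu>_Mplus by (auto simp: Mplus_def space_restrict_space dest: sets_eq_imp_space_eq)

sublocale \<rho>\<^sub>0: finite_measure \<rho>\<^sub>0
  using \<rho>\<^sub>0_Mplus by (simp add: Mplus_def)

sublocale \<mu>: finite_measure \<mu>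
  using \<mu>_Mplus by (simp add: Mplus_def)

text \<open>The mass in \<open>[0,1)\<close> at time \<open>t\<close> if the trajectories are \<open>x + \<xi> t - \<xi> s\<close>, except that
  \<open>\<xi> t\<close> is replaced by the free variable \<open>y\<close> and that mass that entered after time \<open>n\<close> is counted
  regardless of its position. Mass that entered during the last unit of time is still present,
  since the velocity is at most 1; hence \<open>n\<close> is irrelevant as long as \<open>t \<le> n + 1\<close>.\<close>

definition load :: "real \<Rightarrow> (real \<Rightarrow> real) \<Rightarrow> real \<Rightarrow> real \<Rightarrow> real" where
  "load n \<xi> y t = measure \<rho>\<^sub>0 {x\<in>{0..<1}. x + y < 1} +
     measure \<mu> {s\<in>{0<..T}. s \<le> t \<and> (s \<le> n \<longrightarrow> y - \<xi> s < 1)}"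

text \<open>An upper bound for every load, so that \<open>\<alpha> total\<close> is a positive lower
  bound for every speed.\<close>

definition total :: real where
  "total = measure \<rho>\<^sub>0 {0..<1} + measure \<mu> {0<..T}"

text \<open>With \<open>n = T\<close> the position is checked for all influx, so this load is the
  true mass in [0,1).\<close>

definition speed :: "(real \<Rightarrow> real) \<Rightarrow> real \<Rightarrow> real" where
  "speed \<xi> t = \<alpha> (load T \<xi> (\<xi> t) t)"

text \<open>Monotonicity on the whole line makes \<open>\<xi>\<close> Borel measurable and the load
  a difference of monotone functions of time. The equation is imposed up to \<open>b\<close> only,
  so that a front can be built in steps.\<close>

definition front :: "real \<Rightarrow> (real \<Rightarrow> real) \<Rightarrow> bool" where
  "front b \<xi> \<longleftrightarrow> mono \<xi> \<and> (\<forall>t\<in>{0..b}. (speed \<xi> has_integral \<xi> t) {0..t})"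

lemma initial_set: "{x\<in>{0..<1}. x + y < 1} \<in> sets \<rho>\<^sub>0"
  unfolding sets_\<rho>\<^sub>0 by (auto intro!: borel_measurable_less)

lemma influx_set:
  fixes \<xi> :: "real \<Rightarrow> real"
  assumes "\<xi> \<in> borel_measurable borel"
  shows "{s\<in>{0<..T}. s \<le> t \<and> (s \<le> n \<longrightarrow> y - \<xi> s < 1)} \<in> sets \<mu>"
proof -
  have "\<xi> -` {y-1<..} \<in> sets borel"
    using measurable_sets[OF assms, of "{y-1<..}"] by simp
  then have "{0<..T} \<inter> {..t} \<inter> ({n<..} \<union> \<xi> -` {y-1<..}) \<in> sets borel" by auto
  also have "{0<..T} \<inter> {..t} \<inter> ({n<..} \<union> \<xi> -` {y-1<..}) =
      {s\<in>{0<..T}. s \<le> t \<and> (s \<le> n \<longrightarrow> y - \<xi> s < 1)}"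
    by auto
  finally show ?thesis unfolding sets_\<mu> by blast
qed

lemma exited_set:
  fixes \<xi> :: "real \<Rightarrow> real"
  assumes "\<xi> \<in> borel_measurable borel"
  shows "{s\<in>{0<..T}. s \<le> t \<and> s \<le> n \<and> \<xi> s \<le> y - 1} \<in> sets \<mu>"
proof -
  have "\<xi> -` {..y-1} \<in> sets borel"
    using measurable_sets[OF assms, of "{..y-1}"] by simp
  then have "{0<..T} \<inter> {..t} \<inter> {..n} \<inter> \<xi> -` {..y-1} \<in> sets borel" by auto
  also have "{0<..T} \<inter> {..t} \<inter> {..n} \<inter> \<xi> -` {..y-1} =
      {s\<in>{0<..T}. s \<le> t \<and> s \<le> n \<and> \<xi> s \<le> y - 1}"
    by auto
  finally show ?thesis unfolding sets_\<mu> by blast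
qed

lemma interval_set: "{s\<in>{0<..T}. n < s \<and> s \<le> t} \<in> sets \<mu>"
proof -
  have "{s\<in>{0<..T}. n < s \<and> s \<le> t} = {max 0 n<..min T t}" by auto
  then have "{s\<in>{0<..T}. n < s \<and> s \<le> t} \<in> sets borel" by simp
  then show ?thesis by (auto simp: sets_\<mu>)
qed

lemma load_nonneg: "0 \<le> load n \<xi> y t"
  by (simp add: load_def)

lemma load_le_total: "load n \<xi> y t \<le> total"
  unfolding load_def total_def
  by (intro add_mono \<rho>\<^sub>0.finite_measure_mono \<mu>.finite_measure_mono) (auto simp: sets_\<rho>\<^sub>0 sets_\<mu>)

lemma speed_bounds: "\<alpha> total \<le> speed \<xi> t" "speed \<xi> t \<le> 1" "0 < \<alpha> total"
  unfolding speed_def using \<alpha>_antimono[OF load_nonneg load_le_total] \<alpha>_range[OF load_nonneg]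
    \<alpha>_range[OF order_trans[OF load_nonneg load_le_total]]
  by simp_all

section \<open>Dependence of the load on position and time\<close>

lemma load_antimono:
  assumes "\<xi> \<in> borel_measurable borel" "y \<le> y'"
  shows "load n \<xi> y' t \<le> load n \<xi> y t"
  unfolding load_def
  by (intro add_mono \<rho>\<^sub>0.finite_measure_mono \<mu>.finite_measure_mono initial_set influx_set assms(1))
     (use assms(2) in auto)

text \<open>Mass that entered after \<open>n\<close> is counted wherever it is, so its share is
  independent of \<open>y\<close> and of the front. It cancels when two fronts are compared.\<close>

lemma load_split:
  assumes "\<xi> \<in> borel_measurable borel" "n \<le> t"
  shows "load n \<xi> y t = load n \<xi> y n + measure \<mu> {s\<in>{0<..T}. n < s \<and> s \<le> t}"
proof -
  have "{s\<in>{0<..T}. s \<le> t \<and> (s \<le> n \<longrightarrow> y - \<xi> s < 1)} =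
     {s\<in>{0<..T}. s \<le> n \<and> (s \<le> n \<longrightarrow> y - \<xi> s < 1)} \<union> {s\<in>{0<..T}. n < s \<and> s \<le> t}"
    using assms(2) by auto
  then have "measure \<mu> {s\<in>{0<..T}. s \<le> t \<and> (s \<le> n \<longrightarrow> y - \<xi> s < 1)} =
     measure \<mu> {s\<in>{0<..T}. s \<le> n \<and> (s \<le> n \<longrightarrow> y - \<xi> s < 1)} + measure \<mu> {s\<in>{0<..T}. n < s \<and> s \<le> t}"
    by (simp only:) (rule \<mu>.finite_measure_Union[OF influx_set[OF assms(1)] interval_set], fastforce)
  then show ?thesis by (simp add: load_def)
qed

lemma load_cong:
  assumes "\<And>s. s \<in> {0<..T} \<Longrightarrow> s \<le> t \<Longrightarrow> (s \<le> n \<longrightarrow> y - \<xi> s < 1) = (s \<le> m \<longrightarrow> y - \<xi>' s < 1)"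
  shows "load n \<xi> y t = load m \<xi>' y t"
proof -
  have "{s\<in>{0<..T}. s \<le> t \<and> (s \<le> n \<longrightarrow> y - \<xi> s < 1)} = {s\<in>{0<..T}. s \<le> t \<and> (s \<le> m \<longrightarrow> y - \<xi>' s < 1)}"
    using assms by blast
  then show ?thesis by (simp add: load_def)
qed

text \<open>Mass balance: the influx so far grows, and so does the influx that has left; the
  remaining initial mass shrinks and therefore enters \<open>B\<close> with a minus sign.\<close>

lemma load_mono_difference:
  assumes \<xi>: "mono \<xi>" and w: "mono w"
  obtains A B where "mono A" "mono B" "\<And>t. load n \<xi> (w t) t = A t - B t"
proof
  let ?A = "\<lambda>t. measure \<mu> {s\<in>{0<..T}. 0 < s \<and> s \<le> t}"
  let ?B = "\<lambda>t. measure \<mu> {s\<in>{0<..T}. s \<le> t \<and> s \<le> n \<and> \<xi> s \<le> w t - 1} - measure \<rho>\<^sub>0 {x\<in>{0..<1}. x + w t < 1}"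
  show "mono ?A"
    by (intro monoI \<mu>.finite_measure_mono interval_set) auto
  show "mono ?B"
  proof (intro monoI diff_mono \<mu>.finite_measure_mono \<rho>\<^sub>0.finite_measure_mono exited_set initial_set)
    fix s t :: real assume "s \<le> t"
    then have "w s \<le> w t" using w by (rule monoD[rotated])
    then show "{r\<in>{0<..T}. r \<le> s \<and> r \<le> n \<and> \<xi> r \<le> w s - 1} \<subseteq> {r\<in>{0<..T}. r \<le> t \<and> r \<le> n \<and> \<xi> r \<le> w t - 1}"
      "{x\<in>{0..<1}. x + w t < 1} \<subseteq> {x\<in>{0..<1}. x + w s < 1}"
      using \<open>s \<le> t\<close> by auto
  qed (use borel_measurable_mono[OF \<xi>] in auto)
  show "load n \<xi> (w t) t = ?A t - ?B t" for t
  proof -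
    have "{s\<in>{0<..T}. s \<le> t \<and> (s \<le> n \<longrightarrow> w t - \<xi> s < 1)} =
      {s\<in>{0<..T}. 0 < s \<and> s \<le> t} - {s\<in>{0<..T}. s \<le> t \<and> s \<le> n \<and> \<xi> s \<le> w t - 1}"
      by auto
    then have "measure \<mu> {s\<in>{0<..T}. s \<le> t \<and> (s \<le> n \<longrightarrow> w t - \<xi> s < 1)} =
      ?A t - measure \<mu> {s\<in>{0<..T}. s \<le> t \<and> s \<le> n \<and> \<xi> s \<le> w t - 1}"
      by (simp only:)
        (rule \<mu>.finite_measure_Diff[OF interval_set exited_set[OF borel_measurable_mono[OF \<xi>]]], auto)
    then show ?thesis by (simp add: load_def)
  qed
qed

lemma load_measurable:
  assumes "mono \<xi>" "mono w"
  shows "(\<lambda>t. load n \<xi> (w t) t) \<in> borel_measurable borel"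
proof -
  obtain A B where "mono A" "mono B" and *: "\<And>t. load n \<xi> (w t) t = A t - B t"
    using load_mono_difference[OF assms] by metis
  then show ?thesis
    unfolding * by (intro borel_measurable_diff borel_measurable_mono)
qed

text \<open>Used to differentiate the front: off a countable set the speed is continuous, so the
  front has it as its derivative there.\<close>

lemma load_countable_discontinuities:
  assumes "mono \<xi>" "mono w"
  shows "countable {t. \<not> isCont (\<lambda>t. load n \<xi> (w t) t) t}"
proof -
  obtain A B where AB: "mono A" "mono B" and *: "\<And>t. load n \<xi> (w t) t = A t - B t"
    using load_mono_difference[OF assms] by metis
  have "countable ({t. \<not> isCont A t} \<union> {t. \<not> isCont B t})"
    using AB by (simp add: mono_ctble_discont)
  then show ?thesis
    unfolding * by (rule countable_subset[rotated]) (auto intro: continuous_diff)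
qed

lemma continuous_on_\<alpha>: "continuous_on {0..} \<alpha>"
  by (rule lipschitz_on_continuous_on[OF \<alpha>_lipschitz])

text \<open>Continuity of \<alpha> is available on [0,\<infinity>) only. The constant extension to
  the left is continuous everywhere and agrees with \<alpha> on loads, which are
  nonnegative.\<close>

lemma continuous_on_\<alpha>_max: "continuous_on UNIV (\<lambda>x. \<alpha> (max 0 x))"
  by (intro continuous_on_compose2[OF continuous_on_\<alpha>] continuous_intros) auto

lemma \<alpha>_measurable:
  assumes [measurable]: "f \<in> borel_measurable M" and "\<And>t. 0 \<le> f t"
  shows "(\<lambda>t. \<alpha> (f t)) \<in> borel_measurable M"
proof -
  note [measurable] = borel_measurable_continuous_onI[OF continuous_on_\<alpha>_max]
  have "(\<lambda>t. \<alpha> (max 0 (f t))) \<in> borel_measurable M" by measurable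
  then show ?thesis using assms(2) by (simp add: max_absorb2)
qed

lemma speed_measurable: "mono \<xi> \<Longrightarrow> speed \<xi> \<in> borel_measurable borel"
  unfolding speed_def[abs_def] by (intro \<alpha>_measurable load_measurable load_nonneg)

lemma speed_countable_discontinuities:
  assumes "mono \<xi>"
  shows "countable {t. \<not> isCont (speed \<xi>) t}"
proof (rule countable_subset[OF _ load_countable_discontinuities[OF assms assms, of T]], safe)
  fix t assume c: "isCont (\<lambda>t. load T \<xi> (\<xi> t) t) t" and nc: "\<not> isCont (speed \<xi>) t"
  have "isCont (\<lambda>t. \<alpha> (max 0 (load T \<xi> (\<xi> t) t))) t"
    using continuous_on_\<alpha>_max c
    by (intro isCont_o2[OF c]) (simp add: continuous_on_eq_continuous_at)
  then show False using nc by (simp add: speed_def[abs_def] load_nonneg max_absorb2)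
qed

section \<open>Existence of fronts\<close>

lemma front_0: "front 0 (\<lambda>_. 0)"
  by (simp add: front_def mono_def has_integral_refl)

lemma front_eq_0: "front b \<xi> \<Longrightarrow> 0 \<le> b \<Longrightarrow> \<xi> 0 = 0"
  unfolding front_def by (metis atLeastAtMost_iff atLeastAtMost_singleton has_integral_refl(2) has_integral_unique order_refl)

lemma front_increment:
  assumes "front b \<xi>" "0 \<le> s" "s \<le> t" "t \<le> b"
  shows "(speed \<xi> has_integral (\<xi> t - \<xi> s)) {s..t}"
    and "\<xi> t - \<xi> s \<le> t - s" and "\<alpha> total * (t - s) \<le> \<xi> t - \<xi> s"
proof -
  show 1: "(speed \<xi> has_integral (\<xi> t - \<xi> s)) {s..t}"
    using assms by (intro has_integral_increment[of _ _ _ 0]) (auto simp: front_def)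
  show "\<xi> t - \<xi> s \<le> t - s"
    using has_integral_le[OF 1 has_integral_const_real[where c = 1]] speed_bounds(2) assms(3) by simp
  show "\<alpha> total * (t - s) \<le> \<xi> t - \<xi> s"
    using has_integral_le[OF has_integral_const_real[where c = "\<alpha> total"] 1] speed_bounds(1) assms(3)
    by (simp add: mult.commute)
qed

lemma front_extend:
  assumes \<xi>: "front n \<xi>" and "0 \<le> n"
  obtains \<zeta> where "front (n + 1) \<zeta>"
proof -
  have m\<xi>: "mono \<xi>" using \<xi> by (simp add: front_def)
  \<comment> \<open>Up to \<open>n\<close> the known speed is prescribed, so the fixed point must
    reproduce \<open>\<xi>\<close> there. Later, load and \<alpha> are both nonincreasing, so
    \<open>f\<close> is nondecreasing in \<open>y\<close>.\<close>
  define f where "f s y = (if s \<le> n then speed \<xi> s else \<alpha> (load n \<xi> y s))" for s y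
  have f01: "0 \<le> f s y" "f s y \<le> 1" for s y
    using speed_bounds(1,2)[of \<xi> s] speed_bounds(3) \<alpha>_range[OF load_nonneg[of n \<xi> y s]] by (auto simp: f_def)
  obtain \<zeta> where m\<zeta>: "mono \<zeta>" and \<zeta>: "\<And>t. 0 \<le> t \<Longrightarrow> ((\<lambda>s. f s (\<zeta> s)) has_integral \<zeta> t) {0..t}"
  proof (rule monotone_integral_equation[of f])
    show "f s y \<le> f s y'" if "y \<le> y'" for s y y'
      using load_antimono[OF borel_measurable_mono[OF m\<xi>] that] load_nonneg \<alpha>_antimono
      by (auto simp: f_def)
    show "(\<lambda>s. f s (u s)) \<in> borel_measurable borel" if "mono u" for u
    proof -
      note [measurable] = speed_measurable[OF m\<xi>] \<alpha>_measurable[OF load_measurable[OF m\<xi> that] load_nonneg]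
      show ?thesis unfolding f_def by measurable
    qed
  qed (use f01 in auto)
  have agree: "\<zeta> t = \<xi> t" if "t \<in> {0..n}" for t
  proof -
    have "((\<lambda>s. f s (\<zeta> s)) has_integral \<xi> t) {0..t}"
      using \<xi> that by (subst has_integral_cong[where g = "speed \<xi>"]) (auto simp: f_def front_def)
    then show ?thesis using \<zeta>[of t] that has_integral_unique by auto
  qed
  have incr: "\<zeta> t - \<zeta> s \<le> t - s" if "0 \<le> s" "s \<le> t" for s t
  proof -
    have "((\<lambda>s. f s (\<zeta> s)) has_integral (\<zeta> t - \<zeta> s)) {s..t}"
      using that by (intro has_integral_increment[of _ _ _ 0] \<zeta>) auto
    from has_integral_le[OF this has_integral_const_real[where c = 1]] show ?thesis
      using f01 that by simp
  qed
  \<comment> \<open>The auxiliary right-hand side uses the old front; it has to be identified with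
    the speed of the new one.\<close>
  have f_eq: "f s (\<zeta> s) = speed \<zeta> s" if s: "s \<in> {0..n+1}" for s
  proof (cases "s \<le> n")
    case True
    have "load T \<xi> (\<zeta> s) s = load T \<zeta> (\<zeta> s) s"
      by (rule load_cong) (use agree True in auto)
    then show ?thesis using True agree s by (simp add: f_def speed_def)
  next
    case False
    have "load n \<xi> (\<zeta> s) s = load T \<zeta> (\<zeta> s) s"
    proof (rule load_cong)
      fix r assume r: "r \<in> {0<..T}" "r \<le> s"
      \<comment> \<open>For \<open>r \<le> n\<close> the fronts agree. For \<open>r > n\<close> the
        increment is at most \<open>s - r < 1\<close>, so the position condition holds by itself;
        this fixes the step length 1.\<close>
      show "(r \<le> n \<longrightarrow> \<zeta> s - \<xi> r < 1) = (r \<le> T \<longrightarrow> \<zeta> s - \<zeta> r < 1)"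
        using agree[of r] incr[of r s] r s by (cases "r \<le> n") auto
    qed
    then show ?thesis using False by (simp add: f_def speed_def)
  qed
  have "front (n + 1) \<zeta>"
    unfolding front_def
  proof (intro conjI ballI m\<zeta>)
    fix t assume t: "t \<in> {0..n+1}"
    then show "(speed \<zeta> has_integral \<zeta> t) {0..t}"
      using \<zeta>[of t] f_eq by (subst has_integral_cong[where g = "\<lambda>s. f s (\<zeta> s)"]) auto
  qed
  then show thesis by (rule that)
qed

lemma front_exists: obtains \<xi> where "front T \<xi>"
proof -
  have "\<exists>\<xi>. front (real n) \<xi>" for n
  proof (induction n)
    case 0
    then show ?case using front_0 by auto
  next
    case (Suc n)
    then show ?case using front_extend[of "real n"] by (metis of_nat_0_le_iff of_nat_Suc add.commute)
  qed
  moreover obtain n where "T \<le> real n" using real_arch_simple by blast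
  ultimately obtain \<xi> n where "front (real n) \<xi>" "T \<le> real n" by blast
  then show thesis using that[of \<xi>] by (simp add: front_def)
qed

section \<open>Uniqueness of fronts\<close>

text \<open>As the position decreases to \<open>y\<close>, the sets of mass still inside increase,
  and their union is the set at \<open>y\<close> because the exit condition is a strict inequality.
  Continuity of measures from below gives the limit.\<close>

lemma load_right_continuous:
  assumes "\<xi> \<in> borel_measurable borel" and "0 < e"
  obtains d where "d > 0" "\<And>z. z \<le> y + d \<Longrightarrow> load n \<xi> y t - e \<le> load n \<xi> z t"
proof -
  define z where "z k = y + 1 / real (Suc k)" for k
  have z_dec: "z k' \<le> z k" if "k \<le> k'" for k k'
    using that by (simp add: z_def frac_le)
  have zy: "y < z k" for k by (simp add: z_def)
  have z_below: "\<exists>k. z k < b" if "y < b" for b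
    using reals_Archimedean[of "b - y"] that by (auto simp: z_def inverse_eq_divide algebra_simps)
  have zS: "z (Suc k) \<le> z k" for k by (rule z_dec) simp
  have 1: "(\<lambda>k. measure \<rho>\<^sub>0 {x\<in>{0..<1}. x + z k < 1}) \<longlonglongrightarrow> measure \<rho>\<^sub>0 (\<Union>k. {x\<in>{0..<1}. x + z k < 1})"
    by (intro \<rho>\<^sub>0.finite_Lim_measure_incseq incseq_SucI image_subsetI initial_set)
      (auto intro: le_less_trans[OF add_left_mono[OF zS]])
  have 2: "(\<lambda>k. measure \<mu> {s\<in>{0<..T}. s \<le> t \<and> (s \<le> n \<longrightarrow> z k - \<xi> s < 1)})
      \<longlonglongrightarrow> measure \<mu> (\<Union>k. {s\<in>{0<..T}. s \<le> t \<and> (s \<le> n \<longrightarrow> z k - \<xi> s < 1)})"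
    by (intro \<mu>.finite_Lim_measure_incseq incseq_SucI image_subsetI influx_set assms(1))
      (auto intro: le_less_trans[OF diff_right_mono[OF zS]])
  have U1: "(\<Union>k. {x\<in>{0..<1}. x + z k < 1}) = {x\<in>{0..<1}. x + y < 1}"
  proof (intro equalityI subsetI)
    fix x assume "x \<in> {x\<in>{0..<1}. x + y < 1}"
    then show "x \<in> (\<Union>k. {x\<in>{0..<1}. x + z k < 1})"
      using z_below[of "1 - x"] by (auto simp: algebra_simps)
  next
    fix x assume "x \<in> (\<Union>k. {x\<in>{0..<1}. x + z k < 1})"
    then show "x \<in> {x\<in>{0..<1}. x + y < 1}" using zy by (auto; smt)
  qed
  have U2: "(\<Union>k. {s\<in>{0<..T}. s \<le> t \<and> (s \<le> n \<longrightarrow> z k - \<xi> s < 1)}) =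
      {s\<in>{0<..T}. s \<le> t \<and> (s \<le> n \<longrightarrow> y - \<xi> s < 1)}"
  proof (intro equalityI subsetI)
    fix s assume "s \<in> {s\<in>{0<..T}. s \<le> t \<and> (s \<le> n \<longrightarrow> y - \<xi> s < 1)}"
    then show "s \<in> (\<Union>k. {s\<in>{0<..T}. s \<le> t \<and> (s \<le> n \<longrightarrow> z k - \<xi> s < 1)})"
      using z_below[of "1 + \<xi> s"] by (auto simp: algebra_simps)
  next
    fix s assume "s \<in> (\<Union>k. {s\<in>{0<..T}. s \<le> t \<and> (s \<le> n \<longrightarrow> z k - \<xi> s < 1)})"
    then show "s \<in> {s\<in>{0<..T}. s \<le> t \<and> (s \<le> n \<longrightarrow> y - \<xi> s < 1)}" using zy by (auto; smt)
  qed
  have "(\<lambda>k. load n \<xi> (z k) t) \<longlonglongrightarrow> load n \<xi> y t"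
    using tendsto_add[OF 1 2] by (simp only: U1 U2 load_def)
  then have "eventually (\<lambda>k. load n \<xi> y t - e < load n \<xi> (z k) t) sequentially"
    using \<open>0 < e\<close> by (intro order_tendstoD(1)) auto
  then obtain k where k: "load n \<xi> y t - e < load n \<xi> (z k) t"
    using eventually_happens'[OF sequentially_bot] by auto
  show thesis
  proof (rule that)
    show "0 < z k - y" using zy by simp
    show "load n \<xi> y t - e \<le> load n \<xi> x t" if "x \<le> y + (z k - y)" for x
      using load_antimono[OF assms(1), of x "z k" n t] that k by simp
  qed
qed

lemma speed_difference:
  "\<bar>speed \<xi> t - speed \<zeta> t\<bar> \<le> L * \<bar>load T \<xi> (\<xi> t) t - load T \<zeta> (\<zeta> t) t\<bar>"
  using lipschitz_onD[OF \<alpha>_lipschitz, of "load T \<xi> (\<xi> t) t" "load T \<zeta> (\<zeta> t) t"]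
  by (simp add: speed_def load_nonneg dist_real_def)

lemma front_lipschitz:
  assumes "front b \<xi>"
  shows "1-lipschitz_on {0..b} \<xi>"
proof (rule lipschitz_onI)
  fix s t assume "s \<in> {0..b}" "t \<in> {0..b}"
  then show "dist (\<xi> s) (\<xi> t) \<le> 1 * dist s t"
    using front_increment(2)[OF assms, of s t] front_increment(2)[OF assms, of t s]
      monoD[of \<xi> s t] monoD[of \<xi> t s] assms
    by (cases "s \<le> t") (auto simp: front_def dist_real_def)
qed simp

text \<open>Let \<open>D\<close> be the largest distance of the two fronts on \<open>{a..a + e}\<close>. Each of them advances
  by \<open>D\<close> within time \<open>h = D / \<alpha> total\<close>, so the load for \<open>\<xi>\<^sub>2\<close> lies between the loads for \<open>\<xi>\<^sub>1\<close> at
  times shifted by \<open>h\<close> in both directions. After integration the shifts cost at most \<open>2 * h\<close> times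
  the oscillation of the load, which is small by right continuity. Hence \<open>D \<le> D / 2\<close>.\<close>

lemma front_unique_step:
  assumes f1: "front T \<xi>\<^sub>1" and f2: "front T \<xi>\<^sub>2" and a: "0 \<le> a" "a < T"
    and agree: "\<And>t. t \<in> {0..a} \<Longrightarrow> \<xi>\<^sub>1 t = \<xi>\<^sub>2 t"
  obtains e where "0 < e" "a + e \<le> T" "\<And>t. t \<in> {a..a+e} \<Longrightarrow> \<xi>\<^sub>1 t = \<xi>\<^sub>2 t"
proof -
  have m1: "mono \<xi>\<^sub>1" and m2: "mono \<xi>\<^sub>2" using f1 f2 by (auto simp: front_def)
  note meas1 = borel_measurable_mono[OF m1]
  define c where "c = \<alpha> total"
  have c: "0 < c" "c \<le> 1" unfolding c_def using speed_bounds(1,2)[of \<xi>\<^sub>1 0] speed_bounds(3) by auto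
  have L0: "0 \<le> L" using \<alpha>_lipschitz by (simp add: lipschitz_on_def)
  define y where "y = \<xi>\<^sub>1 a"
  have y2: "y = \<xi>\<^sub>2 a" using agree a by (simp add: y_def)
  \<comment> \<open>The position-dependent part of the load. It involves the front up to
    \<open>a\<close> only and is therefore common to both fronts.\<close>
  define G where "G z = load a \<xi>\<^sub>1 z a" for z
  have G_anti: "G z' \<le> G z" if "z \<le> z'" for z z'
    unfolding G_def by (rule load_antimono[OF meas1 that])
  \<comment> \<open>Chosen so that \<open>L * (2 * h * \<eta>) \<le> D / 2\<close> for
    \<open>h = D / c\<close>; \<open>L + 1\<close> keeps the denominator positive.\<close>
  define \<eta> where "\<eta> = c / (4 * (L + 1))"
  have "0 < \<eta>" using c L0 by (simp add: \<eta>_def)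
  obtain d where "d > 0" and d: "\<And>z. z \<le> y + d \<Longrightarrow> G y - \<eta> \<le> G z"
    using load_right_continuous[OF meas1 \<open>0 < \<eta>\<close>, of y a a] unfolding G_def by blast
  \<comment> \<open>The bound 1 keeps the influx after \<open>a\<close> inside, \<open>d\<close>
    keeps \<open>G\<close> within \<open>\<eta>\<close> of \<open>G y\<close>, and
    \<open>T - a\<close> keeps times below \<open>T\<close>. The factor \<open>c / 2\<close> in
    \<open>e\<close> leaves room for the shift: \<open>e + h \<le> E\<close>.\<close>
  define E where "E = Min {1, d, T - a}"
  have E: "0 < E" "E \<le> 1" "E \<le> d" "E \<le> T - a" using a \<open>d > 0\<close> by (auto simp: E_def)
  define e where "e = E * c / 2"
  have e0: "0 < e" using c E by (simp add: e_def)
  have e_le: "e \<le> E / 2" using c E by (simp add: e_def mult_left_le)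
  have ec: "e / c = E / 2" using c by (simp add: e_def)
  have incr: "\<xi>\<^sub>1 t - \<xi>\<^sub>1 s \<le> t - s" "c * (t - s) \<le> \<xi>\<^sub>1 t - \<xi>\<^sub>1 s"
    "\<xi>\<^sub>2 t - \<xi>\<^sub>2 s \<le> t - s" "c * (t - s) \<le> \<xi>\<^sub>2 t - \<xi>\<^sub>2 s" if "0 \<le> s" "s \<le> t" "t \<le> T" for s t
    using front_increment(2,3)[OF f1 that] front_increment(2,3)[OF f2 that] by (auto simp: c_def)
  have load_eq: "load T \<xi> (\<xi> s) s = G (\<xi> s) + measure \<mu> {r\<in>{0<..T}. a < r \<and> r \<le> s}"
    if s: "s \<in> {a..a+e}" and f: "front T \<xi>" and ag: "\<And>t. t \<in> {0..a} \<Longrightarrow> \<xi> t = \<xi>\<^sub>1 t" for s \<xi>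
  proof -
    have "load T \<xi> (\<xi> s) s = load a \<xi>\<^sub>1 (\<xi> s) s"
    proof (rule load_cong)
      fix r assume r: "r \<in> {0<..T}" "r \<le> s"
      have "\<xi> s - \<xi> r \<le> s - r" using front_increment(2)[OF f, of r s] r s e_le E a by auto
      then show "(r \<le> T \<longrightarrow> \<xi> s - \<xi> r < 1) = (r \<le> a \<longrightarrow> \<xi> s - \<xi>\<^sub>1 r < 1)"
        using ag[of r] r s e_le E by (cases "r \<le> a") auto
    qed
    also have "\<dots> = G (\<xi> s) + measure \<mu> {r\<in>{0<..T}. a < r \<and> r \<le> s}"
      unfolding G_def using s by (intro load_split[OF meas1]) auto
    finally show ?thesis .
  qed
  define \<delta> where "\<delta> t = \<bar>\<xi>\<^sub>1 t - \<xi>\<^sub>2 t\<bar>" for t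
  have "continuous_on {0..T} \<xi>\<^sub>1" "continuous_on {0..T} \<xi>\<^sub>2"
    using front_lipschitz[OF f1] front_lipschitz[OF f2] by (auto intro: lipschitz_on_continuous_on)
  then have cont: "continuous_on {a..a+e} \<delta>"
    unfolding \<delta>_def using a e_le E by (intro continuous_intros) (auto elim!: continuous_on_subset)
  obtain t\<^sub>0 where t0: "t\<^sub>0 \<in> {a..a+e}" and max: "\<And>t. t \<in> {a..a+e} \<Longrightarrow> \<delta> t \<le> \<delta> t\<^sub>0"
    using continuous_attains_sup[OF _ _ cont] e0 by auto
  define D where "D = \<delta> t\<^sub>0"
  define h where "h = D / c"
  have D0: "0 \<le> D" by (simp add: D_def \<delta>_def)
  then have h0: "0 \<le> h" using c by (simp add: h_def)
  have ch: "c * h = D" using c by (simp add: h_def)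
  \<comment> \<open>Both fronts start at \<open>y\<close> and advance by an amount between 0 and
    \<open>e\<close>.\<close>
  have "D \<le> e"
    using incr[of a t\<^sub>0] t0 a e_le E c y2 y_def m1[THEN monoD, of a t\<^sub>0] m2[THEN monoD, of a t\<^sub>0]
    by (auto simp: D_def \<delta>_def abs_le_iff)
  then have "h \<le> E / 2" using c by (simp add: h_def flip: ec) (simp add: divide_right_mono)
  \<comment> \<open>The load of the first front as a function of time, extended constantly to the
    left of \<open>a\<close> since \<open>s - h\<close> may fall below \<open>a\<close>.\<close>
  define g where "g s = G (\<xi>\<^sub>1 (max a s))" for s
  have g_anti: "antimono g"
    unfolding g_def by (intro antimonoI G_anti monoD[OF m1]) auto
  have g_le: "g s \<le> G y" for s
    unfolding g_def y_def by (intro G_anti monoD[OF m1]) auto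
  have g_ge: "G y - \<eta> \<le> g s" if "s \<le> a + e + h" for s
  proof -
    have "\<xi>\<^sub>1 (max a s) - \<xi>\<^sub>1 a \<le> max a s - a"
      using that a e_le E \<open>h \<le> E / 2\<close> by (intro incr) auto
    then have "\<xi>\<^sub>1 (max a s) \<le> y + d" using that a e_le E \<open>h \<le> E / 2\<close> \<open>d > 0\<close> by (auto simp: y_def)
    then show ?thesis unfolding g_def by (rule d)
  qed
  have sandwich: "\<bar>G (\<xi>\<^sub>1 s) - G (\<xi>\<^sub>2 s)\<bar> \<le> g (s - h) - g (s + h)" if s: "s \<in> {a..a+e}" for s
  proof -
    have Ds: "\<bar>\<xi>\<^sub>1 s - \<xi>\<^sub>2 s\<bar> \<le> D" using max[OF s] by (simp add: D_def \<delta>_def)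
    have l: "\<xi>\<^sub>1 (max a (s - h)) \<le> \<xi>\<^sub>2 s"
    proof (cases "s - h \<le> a")
      case True
      then show ?thesis using monoD[OF m2, of a s] s y2 by (simp add: y_def max_def)
    next
      case False
      have "c * h \<le> \<xi>\<^sub>1 s - \<xi>\<^sub>1 (s - h)" using incr(2)[of "s - h" s] False s a e_le E h0 by auto
      then show ?thesis using Ds ch False by (simp add: max_def)
    qed
    have "c * h \<le> \<xi>\<^sub>1 (s + h) - \<xi>\<^sub>1 s" using incr(2)[of s "s + h"] s a e_le E \<open>h \<le> E / 2\<close> h0 by auto
    then have u: "\<xi>\<^sub>2 s \<le> \<xi>\<^sub>1 (max a (s + h))" using Ds ch s h0 by (simp add: max_def)
    have l1: "\<xi>\<^sub>1 (max a (s - h)) \<le> \<xi>\<^sub>1 s" and u1: "\<xi>\<^sub>1 s \<le> \<xi>\<^sub>1 (max a (s + h))"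
      using s h0 by (auto intro!: monoD[OF m1])
    show ?thesis
      using G_anti[OF l] G_anti[OF u] G_anti[OF l1] G_anti[OF u1] by (simp add: g_def)
  qed
  have step: "\<delta> t \<le> D / 2" if t: "t \<in> {a..a+e}" for t
  proof -
    have tT: "a \<le> t" "t \<le> T" using t a e_le E by auto
    have I: "((\<lambda>s. speed \<xi>\<^sub>1 s - speed \<xi>\<^sub>2 s) has_integral (\<xi>\<^sub>1 t - \<xi>\<^sub>2 t)) {a..t}"
      using has_integral_diff[OF front_increment(1)[OF f1 a(1) tT] front_increment(1)[OF f2 a(1) tT]] y2
      by (simp add: y_def)
    have q: "G y - \<eta> \<le> g x" if "x \<le> t + h" for x using that t by (intro g_ge) auto
    note sh = integral_shift_difference_antimono[OF g_anti h0 tT(1) g_le q]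
    have "norm (integral {a..t} (\<lambda>s. speed \<xi>\<^sub>1 s - speed \<xi>\<^sub>2 s)) \<le> integral {a..t} (\<lambda>s. L * (g (s - h) - g (s + h)))"
    proof (rule integral_norm_bound_integral)
      show "(\<lambda>s. speed \<xi>\<^sub>1 s - speed \<xi>\<^sub>2 s) integrable_on {a..t}" using I by blast
      show "(\<lambda>s. L * (g (s - h) - g (s + h))) integrable_on {a..t}"
        using integrable_cmul[OF sh(1), of L] by simp
      fix s assume "s \<in> {a..t}"
      then have s: "s \<in> {a..a+e}" using t by auto
      have "\<bar>speed \<xi>\<^sub>1 s - speed \<xi>\<^sub>2 s\<bar> \<le> L * \<bar>G (\<xi>\<^sub>1 s) - G (\<xi>\<^sub>2 s)\<bar>"
        using speed_difference[of \<xi>\<^sub>1 s \<xi>\<^sub>2] load_eq[OF s f1] load_eq[OF s f2] agree by simp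
      also have "\<dots> \<le> L * (g (s - h) - g (s + h))"
        by (intro mult_left_mono sandwich s L0)
      finally show "norm (speed \<xi>\<^sub>1 s - speed \<xi>\<^sub>2 s) \<le> L * (g (s - h) - g (s + h))" by simp
    qed
    also have "\<dots> \<le> L * (2 * h * \<eta>)"
      using mult_left_mono[OF sh(2) L0] by simp
    also have "\<dots> = D * (L / (L + 1)) / 2"
      using c L0 by (simp add: h_def \<eta>_def field_simps)
    also have "\<dots> \<le> D / 2"
      by (intro divide_right_mono mult_left_le D0) (use L0 in auto)
    finally show ?thesis using integral_unique[OF I] by (simp add: \<delta>_def)
  qed
  \<comment> \<open>At the maximum point the estimate reads \<open>D \<le> D / 2\<close>.\<close>
  from step[OF t0] D0 have "D = 0" by (simp add: D_def)
  then have "\<xi>\<^sub>1 t = \<xi>\<^sub>2 t" if "t \<in> {a..a+e}" for t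
    using max[OF that] by (simp add: D_def \<delta>_def)
  then show thesis using that[of e] e0 e_le E by auto
qed

text \<open>Continuation: agreement up to every time below the supremum passes to the supremum by
  the speed bound, and \<open>front_unique_step\<close> carries it further unless the supremum is
  \<open>T\<close>.\<close>

lemma front_unique:
  assumes f1: "front T \<xi>\<^sub>1" and f2: "front T \<xi>\<^sub>2" and t: "t \<in> {0..T}"
  shows "\<xi>\<^sub>1 t = \<xi>\<^sub>2 t"
proof -
  define A where "A = {b\<in>{0..T}. \<forall>t\<in>{0..b}. \<xi>\<^sub>1 t = \<xi>\<^sub>2 t}"
  define b where "b = Sup A"
  have A0: "0 \<in> A" using front_eq_0[OF f1] front_eq_0[OF f2] T_pos by (auto simp: A_def)
  have bdd: "bdd_above A" by (auto simp: A_def)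
  have b: "0 \<le> b" "b \<le> T"
    using A0 bdd by (auto simp: b_def A_def intro!: cSup_upper cSup_least)
  have below: "\<xi>\<^sub>1 t = \<xi>\<^sub>2 t" if "0 \<le> t" "t < b" for t
  proof -
    obtain b' where "b' \<in> A" "t < b'"
      using less_cSupD[of A t] A0 \<open>t < b\<close> by (auto simp: b_def)
    then show ?thesis using that by (auto simp: A_def)
  qed
  have at_b: "\<xi>\<^sub>1 b = \<xi>\<^sub>2 b"
  proof (rule ccontr)
    assume ne: "\<xi>\<^sub>1 b \<noteq> \<xi>\<^sub>2 b"
    then have "0 < b" using A0 b by (cases "b = 0") (auto simp: A_def)
    \<comment> \<open>So late that each front gains at most half the gap after \<open>s\<close>.
      Both gains are nonnegative and start from a common value, so they cannot produce the whole
      gap.\<close>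
    define s where "s = max 0 (b - \<bar>\<xi>\<^sub>1 b - \<xi>\<^sub>2 b\<bar> / 2)"
    have s: "0 \<le> s" "s < b" using \<open>0 < b\<close> ne by (auto simp: s_def)
    have "\<xi>\<^sub>1 b - \<xi>\<^sub>1 s \<le> b - s" "\<xi>\<^sub>2 b - \<xi>\<^sub>2 s \<le> b - s"
      using front_increment(2)[OF f1, of s b] front_increment(2)[OF f2, of s b] s b by auto
    moreover have "\<xi>\<^sub>1 s \<le> \<xi>\<^sub>1 b" "\<xi>\<^sub>2 s \<le> \<xi>\<^sub>2 b"
      using f1 f2 s by (auto simp: front_def mono_def)
    moreover have "b - s \<le> \<bar>\<xi>\<^sub>1 b - \<xi>\<^sub>2 b\<bar> / 2" by (auto simp: s_def max_def)
    ultimately show False using below[OF s] ne by (auto simp: abs_if split: if_splits)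
  qed
  have upto: "\<xi>\<^sub>1 t = \<xi>\<^sub>2 t" if "t \<in> {0..b}" for t
    using below[of t] at_b that by (cases "t = b") auto
  have "b = T"
  proof (rule ccontr)
    assume "b \<noteq> T"
    then have "b < T" using b by simp
    obtain e where e: "0 < e" "b + e \<le> T" "\<And>t. t \<in> {b..b+e} \<Longrightarrow> \<xi>\<^sub>1 t = \<xi>\<^sub>2 t"
      using front_unique_step[OF f1 f2 b(1) \<open>b < T\<close> upto] by blast
    have "b + e \<in> A"
      using e b upto by (auto simp: A_def) (metis atLeastAtMost_iff linorder_le_cases)
    then have "b + e \<le> b" unfolding b_def using bdd by (intro cSup_upper) (simp_all add: b_def)
    then show False using e by simp
  qed
  then show ?thesis using upto t by simp
qed

section \<open>Fronts and Lagrangian solutions\<close>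

text \<open>The right-hand side of the Lagrangian representation for the flow
  \<open>x + \<xi> t - \<xi> s\<close>, with the integrals of indicators written as measures of
  preimages.\<close>

definition transported :: "(real \<Rightarrow> real) \<Rightarrow> real \<Rightarrow> real set \<Rightarrow> ennreal" where
  "transported \<xi> t E = emeasure \<rho>\<^sub>0 {x\<in>{0..<1}. x + \<xi> t \<in> E} +
     emeasure \<mu> {s\<in>{0<..T}. s \<le> t \<and> \<xi> t - \<xi> s \<in> E}"

lemma transported_sets:
  assumes "mono \<xi>" "E \<in> sets borel"
  shows "{x\<in>{0..<1}. x + \<xi> t \<in> E} \<in> sets \<rho>\<^sub>0" "{s\<in>{0<..T}. s \<le> t \<and> \<xi> t - \<xi> s \<in> E} \<in> sets \<mu>"
proof -
  note [measurable] = borel_measurable_mono[OF assms(1)] assms(2)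
  have "(\<lambda>x. x + \<xi> t) -` E \<inter> space borel \<in> sets borel" "(\<lambda>s. \<xi> t - \<xi> s) -` E \<inter> space borel \<in> sets borel"
    by measurable
  then have "{0..<1} \<inter> (\<lambda>x. x + \<xi> t) -` E \<in> sets borel" "{0<..T} \<inter> {..t} \<inter> (\<lambda>s. \<xi> t - \<xi> s) -` E \<in> sets borel"
    by auto
  moreover have "{0..<1} \<inter> (\<lambda>x. x + \<xi> t) -` E = {x\<in>{0..<1}. x + \<xi> t \<in> E}"
    "{0<..T} \<inter> {..t} \<inter> (\<lambda>s. \<xi> t - \<xi> s) -` E = {s\<in>{0<..T}. s \<le> t \<and> \<xi> t - \<xi> s \<in> E}" by auto
  ultimately show "{x\<in>{0..<1}. x + \<xi> t \<in> E} \<in> sets \<rho>\<^sub>0" "{s\<in>{0<..T}. s \<le> t \<and> \<xi> t - \<xi> s \<in> E} \<in> sets \<mu>"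
    unfolding sets_\<rho>\<^sub>0 sets_\<mu> by auto
qed

text \<open>By monotonicity no mass lies to the left of 0, so only the condition at the outlet 1
  remains.\<close>

lemma transported_unit_interval:
  assumes "mono \<xi>" "\<xi> 0 = 0" "0 \<le> t"
  shows "transported \<xi> t {0..<1} = ennreal (load T \<xi> (\<xi> t) t)"
proof -
  have "0 \<le> \<xi> t" using monoD[OF assms(1) assms(3)] assms(2) by simp
  then have 1: "{x\<in>{0..<1}. x + \<xi> t \<in> {0..<1}} = {x\<in>{0..<1}. x + \<xi> t < 1}" by auto
  have 2: "{s\<in>{0<..T}. s \<le> t \<and> \<xi> t - \<xi> s \<in> {0..<1}} = {s\<in>{0<..T}. s \<le> t \<and> (s \<le> T \<longrightarrow> \<xi> t - \<xi> s < 1)}"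
    using monoD[OF assms(1)] by auto
  show ?thesis
    unfolding transported_def 1 2 load_def
    by (simp add: \<rho>\<^sub>0.emeasure_eq_measure \<mu>.emeasure_eq_measure)
qed

lemma flow_integrals_eq_transported:
  assumes "mono \<xi>" "\<xi> 0 = 0" and t: "t \<in> {0..T}" and E: "E \<in> sets borel"
    and X: "\<And>r x. 0 \<le> r \<Longrightarrow> r \<le> t \<Longrightarrow> 0 \<le> x \<Longrightarrow> X t r x = x + \<xi> t - \<xi> r"
  shows "(\<integral>\<^sup>+x. indicator E (X t 0 x) \<partial>\<rho>\<^sub>0) + (\<integral>\<^sup>+s\<in>{0<..t}. indicator E (X t s 0) \<partial>\<mu>) =
    transported \<xi> t E"
proof -
  have "(\<integral>\<^sup>+x. indicator E (X t 0 x) \<partial>\<rho>\<^sub>0) = (\<integral>\<^sup>+x. indicator {x\<in>{0..<1}. x + \<xi> t \<in> E} x \<partial>\<rho>\<^sub>0)"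
    by (rule nn_integral_cong) (use X assms in \<open>auto simp: space_\<rho>\<^sub>0 indicator_def\<close>)
  moreover have "(\<integral>\<^sup>+s\<in>{0<..t}. indicator E (X t s 0) \<partial>\<mu>) =
      (\<integral>\<^sup>+s. indicator {s\<in>{0<..T}. s \<le> t \<and> \<xi> t - \<xi> s \<in> E} s \<partial>\<mu>)"
    by (rule nn_integral_cong) (use X t in \<open>auto simp: space_\<mu> indicator_def\<close>)
  ultimately show ?thesis
    using transported_sets[OF assms(1) E] by (simp add: transported_def)
qed

lemma countably_additive_transported:
  assumes "mono \<xi>"
  shows "countably_additive (sets (restrict_space borel {0..<1})) (transported \<xi> t)"
proof (rule countably_additiveI)
  fix A :: "nat \<Rightarrow> real set"
  assume A: "range A \<subseteq> sets (restrict_space borel {0..<1})" "disjoint_family A"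
  then have Ab: "A i \<in> sets borel" for i 
    using sets_restrict_space_iff[of "{0..<1}" borel "A i"] by auto
  have "(\<Sum>i. emeasure \<rho>\<^sub>0 {x\<in>{0..<1}. x + \<xi> t \<in> A i}) = emeasure \<rho>\<^sub>0 (\<Union>i. {x\<in>{0..<1}. x + \<xi> t \<in> A i})"
    using A(2) transported_sets(1)[OF assms Ab] by (intro suminf_emeasure) (auto simp: disjoint_family_on_def)
  moreover have "(\<Sum>i. emeasure \<mu> {s\<in>{0<..T}. s \<le> t \<and> \<xi> t - \<xi> s \<in> A i}) =
      emeasure \<mu> (\<Union>i. {s\<in>{0<..T}. s \<le> t \<and> \<xi> t - \<xi> s \<in> A i})"
    using A(2) transported_sets(2)[OF assms Ab] by (intro suminf_emeasure) (auto simp: disjoint_family_on_def)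
  moreover have "(\<Union>i. {x\<in>{0..<1}. x + \<xi> t \<in> A i}) = {x\<in>{0..<1}. x + \<xi> t \<in> (\<Union>i. A i)}"
    "(\<Union>i. {s\<in>{0<..T}. s \<le> t \<and> \<xi> t - \<xi> s \<in> A i}) = {s\<in>{0<..T}. s \<le> t \<and> \<xi> t - \<xi> s \<in> (\<Union>i. A i)}"
    by auto
  ultimately show "(\<Sum>i. transported \<xi> t (A i)) = transported \<xi> t (\<Union>i. A i)"
    by (simp add: transported_def flip: suminf_add)
qed

section \<open>Passage between solutions and fronts\<close>

text \<open>The front is the trajectory that starts in 0 at time 0. By the fundamental theorem every
  trajectory is the integral of the same velocity, hence a translate of the front, and
  \<open>W\<close> becomes its load.\<close>

lemma lagrangian_solution_front:
  assumes "lagrangian_solution \<alpha> T \<rho>\<^sub>0 \<mu> \<rho>"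
  obtains \<xi> where "front T \<xi>"
    "\<And>t E. t \<in> {0..T} \<Longrightarrow> E \<in> sets (restrict_space borel {0..<1}) \<Longrightarrow> emeasure (\<rho> t) E = transported \<xi> t E"
proof -
  define W where "W t = measure (\<rho> t) {0..<1}" for t
  define v where "v t = \<alpha> (W t)" for t
  have \<rho>: "\<rho> t \<in> Mplus {0..<1}" if "t \<in> {0..T}" for t
    using assms that by (auto simp: lagrangian_solution_def)
  obtain X where X: "is_semiflow T (\<lambda>t x. v t) X"
    and em: "\<And>t E. t \<in> {0..T} \<Longrightarrow> E \<in> sets (restrict_space borel {0..<1}) \<Longrightarrow>
      emeasure (\<rho> t) E = (\<integral>\<^sup>+x. indicator E (X t 0 x) \<partial>\<rho>\<^sub>0) + (\<integral>\<^sup>+s\<in>{0<..t}. indicator E (X t s 0) \<partial>\<mu>)"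
    using assms unfolding lagrangian_solution_def Let_def v_def W_def by blast
  have v: "0 < v t" "v t \<le> 1" for t unfolding v_def using \<alpha>_range by (auto simp: W_def)
  have int: "(v has_integral (X t r x - x)) {r..t}" if "0 \<le> r" "r \<le> t" "t \<le> T" "0 \<le> x" for t r x
  proof -
    have F: "X r r x = x" "absolutely_continuous_fun_on r T (\<lambda>t. X t r x)"
      "AE t in lebesgue_on {r..T}. ((\<lambda>t'. X t' r x) has_real_derivative v t) (at t within {r..T})"
      using X that unfolding is_semiflow_def by auto
    have ac: "absolutely_continuous_fun_on r t (\<lambda>t. X t r x)"
      by (rule absolutely_continuous_fun_on_subinterval[OF F(2)]) (use that in auto)
    define N where "N = {t\<in>{r..T}. \<not> ((\<lambda>t'. X t' r x) has_real_derivative v t) (at t within {r..T})}"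
    have N: "negligible N" using F(3) by (subst (asm) AE_lebesgue_on_iff_negligible) (auto simp: N_def)
    have "(v has_integral (X t r x - X r r x)) {r..t}"
    proof (rule fundamental_theorem_of_calculus_absolutely_continuous[OF \<open>r \<le> t\<close> ac N])
      fix s assume "s \<in> {r..t} - N"
      then show "((\<lambda>t'. X t' r x) has_real_derivative v s) (at s within {r..t})"
        using \<open>t \<le> T\<close> by (auto simp: N_def intro: has_field_derivative_subset)
    qed
    then show ?thesis using F(1) by simp
  qed
  \<comment> \<open>The semiflow is unconstrained outside the time interval; clamping the time makes
    \<open>\<xi>\<close> monotone on the whole line.\<close>
  define \<xi> where "\<xi> t = X (max 0 (min t T)) 0 0" for t
  have \<xi>_int: "(v has_integral \<xi> t) {0..t}" if "t \<in> {0..T}" for t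
    using int[of 0 t 0] that by (simp add: \<xi>_def)
  have \<xi>_incr: "(v has_integral (\<xi> t - \<xi> s)) {s..t}" if "0 \<le> s" "s \<le> t" "t \<le> T" for s t
    using that by (intro has_integral_increment[of _ _ _ 0] \<xi>_int) auto
  have \<xi>0: "\<xi> 0 = 0" using X T_pos by (simp add: \<xi>_def is_semiflow_def)
  have m: "mono \<xi>"
  proof (rule monoI)
    fix s t :: real assume "s \<le> t"
    let ?s = "max 0 (min s T)" and ?t = "max 0 (min t T)"
    have "(v has_integral (\<xi> ?t - \<xi> ?s)) {?s..?t}" using \<open>s \<le> t\<close> T_pos by (intro \<xi>_incr) auto
    then have "0 \<le> \<xi> ?t - \<xi> ?s" by (rule has_integral_nonneg) (use v in \<open>auto intro: less_imp_le\<close>)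
    then show "\<xi> s \<le> \<xi> t" using T_pos by (simp add: \<xi>_def)
  qed
  have X_eq: "X t r x = x + \<xi> t - \<xi> r" if "0 \<le> r" "r \<le> t" "t \<le> T" "0 \<le> x" for t r x
    using has_integral_unique[OF int[OF that] \<xi>_incr[OF that(1-3)]] by simp
  have tr: "emeasure (\<rho> t) E = transported \<xi> t E" if "t \<in> {0..T}" "E \<in> sets (restrict_space borel {0..<1})" for t E
    using em[OF that] flow_integrals_eq_transported[OF m \<xi>0, of t E X] X_eq that
    by (simp add: sets_restrict_space_iff)
  have W_eq: "W t = load T \<xi> (\<xi> t) t" if "t \<in> {0..T}" for t
    using tr[OF that, of "{0..<1}"] transported_unit_interval[OF m \<xi>0, of t] that
    by (simp add: W_def measure_def sets_restrict_space_iff load_nonneg)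
  have "front T \<xi>"
    unfolding front_def
  proof (intro conjI ballI m)
    fix t assume t: "t \<in> {0..T}"
    show "(speed \<xi> has_integral \<xi> t) {0..t}"
      by (rule has_integral_eq[OF _ \<xi>_int[OF t]]) (use t W_eq in \<open>auto simp: v_def speed_def\<close>)
  qed
  then show thesis using tr by (rule that)
qed

text \<open>The translates of the front form the semiflow: they are absolutely continuous because
  the front is 1-Lipschitz, and they have the right derivative wherever the speed is continuous, so
  off a countable set.\<close>

lemma front_lagrangian_solution:
  assumes f: "front T \<xi>" and "\<And>t. t \<in> {0..T} \<Longrightarrow> \<rho> t \<in> Mplus {0..<1}"
    and em: "\<And>t E. t \<in> {0..T} \<Longrightarrow> E \<in> sets (restrict_space borel {0..<1}) \<Longrightarrow> emeasure (\<rho> t) E = transported \<xi> t E"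
  shows "lagrangian_solution \<alpha> T \<rho>\<^sub>0 \<mu> \<rho>"
proof -
  have m: "mono \<xi>" using f by (simp add: front_def)
  have \<xi>0: "\<xi> 0 = 0" using front_eq_0[OF f] T_pos by simp
  define W where "W t = measure (\<rho> t) {0..<1}" for t
  have W_eq: "W t = load T \<xi> (\<xi> t) t" if "t \<in> {0..T}" for t
    using em[OF that, of "{0..<1}"] transported_unit_interval[OF m \<xi>0, of t] that
    by (simp add: W_def measure_def sets_restrict_space_iff load_nonneg)
  then have v_eq: "\<alpha> (W t) = speed \<xi> t" if "t \<in> {0..T}" for t
    using that by (simp add: speed_def)
  have W_meas: "W \<in> borel_measurable (lebesgue_on {0..T})"
  proof (subst measurable_cong)
    show "(\<lambda>t. load T \<xi> (\<xi> t) t) \<in> borel_measurable (lebesgue_on {0..T})"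
      using load_measurable[OF m m] by (intro measurable_restrict_space1) (simp add: measurable_completion)
  qed (use W_eq in simp)
  define X where "X t r x = x + \<xi> t - \<xi> r" for t r x
  have "velocity_field T (\<lambda>t x. \<alpha> (W t))"
  proof -
    have "speed \<xi> \<in> borel_measurable (lebesgue_on {0..T})"
      using speed_measurable[OF m] by (intro measurable_restrict_space1) (simp add: measurable_completion)
    then have "integrable (lebesgue_on {0..T}) (speed \<xi>)"
    proof (rule measurable_bounded_by_integrable_imp_lebesgue_integrable[where g = "\<lambda>_. 1"])
      show "norm (speed \<xi> t) \<le> 1" for t
        using speed_bounds(1,2)[of \<xi> t] speed_bounds(3) by simp
    qed auto
    then have "integrable (lebesgue_on {0..T}) (\<lambda>t. \<alpha> (W t))"
      by (subst Bochner_Integration.integrable_cong[OF refl, where g = "speed \<xi>"]) (auto simp: v_eq)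
    then show ?thesis using \<alpha>_range by (auto simp: velocity_field_def W_def)
  qed
  moreover have "X t r x \<ge> 0" if "r \<in> {0..T}" "t \<in> {r..T}" "x \<ge> 0" for t r x
    using that monoD[OF m, of r t] by (simp add: X_def)
  moreover have "absolutely_continuous_fun_on r T (\<lambda>t. X t r x)" if "r \<in> {0..T}" for r x
    unfolding absolutely_continuous_fun_on_def
  proof (intro allI impI)
    fix \<epsilon> :: real assume "\<epsilon> > 0"
    show "\<exists>\<delta>>0. \<forall>(n::nat) l u. (\<forall>i<n. r \<le> l i \<and> l i < u i \<and> u i \<le> T) \<longrightarrow>
        disjoint_family_on (\<lambda>i. {l i<..<u i}) {..<n} \<longrightarrow> (\<Sum>i<n. u i - l i) < \<delta> \<longrightarrow>
        (\<Sum>i<n. \<bar>X (u i) r x - X (l i) r x\<bar>) < \<epsilon>"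
    \<comment> \<open>With Lipschitz constant 1, \<open>\<delta> = \<epsilon>\<close> works.\<close>
    proof (intro exI[of _ \<epsilon>] conjI \<open>\<epsilon> > 0\<close> allI impI)
      fix n :: nat and l u
      assume lu: "\<forall>i<n. r \<le> l i \<and> l i < u i \<and> u i \<le> T" and small: "(\<Sum>i<n. u i - l i) < \<epsilon>"
      have "\<bar>X (u i) r x - X (l i) r x\<bar> \<le> u i - l i" if "i < n" for i
      proof -
        have "l i \<in> {0..T}" "u i \<in> {0..T}" "l i < u i"
          using lu[rule_format, OF that] \<open>r \<in> {0..T}\<close> by auto
        then show ?thesis using lipschitz_onD[OF front_lipschitz[OF f], of "u i" "l i"]
          by (simp add: X_def dist_real_def)
      qed
      then have "(\<Sum>i<n. \<bar>X (u i) r x - X (l i) r x\<bar>) \<le> (\<Sum>i<n. u i - l i)" by (intro sum_mono) simp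
      then show "(\<Sum>i<n. \<bar>X (u i) r x - X (l i) r x\<bar>) < \<epsilon>" using small by simp
    qed
  qed
  moreover have "AE t in lebesgue_on {r..T}. ((\<lambda>t'. X t' r x) has_real_derivative \<alpha> (W t)) (at t within {r..T})"
    if r: "r \<in> {0..T}" for r x
  proof -
    have "((\<lambda>t'. X t' r x) has_real_derivative \<alpha> (W t)) (at t within {r..T})"
      if t: "t \<in> {r..T}" and c: "isCont (speed \<xi>) t" for t
    proof -
      have "speed \<xi> integrable_on {r..T}"
        using front_increment(1)[OF f, of r T] r by auto
      then have "((\<lambda>u. integral {r..u} (speed \<xi>)) has_vector_derivative speed \<xi> t) (at t within ({r..T} - {}))"
        using t c by (intro integral_has_vector_derivative_continuous_at) (auto intro: continuous_at_imp_continuous_within)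
      then have "((\<lambda>u. x + integral {r..u} (speed \<xi>)) has_vector_derivative speed \<xi> t) (at t within {r..T})"
        using has_vector_derivative_add[OF has_vector_derivative_const[of x]] by fastforce
      then have "((\<lambda>t'. X t' r x) has_vector_derivative speed \<xi> t) (at t within {r..T})"
      proof (rule has_vector_derivative_transform[OF t, rotated 1])
        fix u assume "u \<in> {r..T}"
        then show "X u r x = x + integral {r..u} (speed \<xi>)"
          using integral_unique[OF front_increment(1)[OF f, of r u]] r by (simp add: X_def)
      qed
      then show ?thesis
        using v_eq[of t] t r by (simp add: has_real_derivative_iff_has_vector_derivative)
    qed
    then have "{t\<in>{r..T}. \<not> ((\<lambda>t'. X t' r x) has_real_derivative \<alpha> (W t)) (at t within {r..T})} \<subseteq>
        {t. \<not> isCont (speed \<xi>) t}"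
      by blast
    moreover have "negligible {t. \<not> isCont (speed \<xi>) t}"
      using countable_imp_null_set_lborel[OF speed_countable_discontinuities[OF m]]
      by (simp add: negligible_iff_null_sets null_sets_completionI)
    ultimately show ?thesis
      by (subst AE_lebesgue_on_iff_negligible) (auto intro: negligible_subset)
  qed
  ultimately have "is_semiflow T (\<lambda>t x. \<alpha> (W t)) X"
    by (simp add: is_semiflow_def X_def)
  moreover have "emeasure (\<rho> t) E =
      (\<integral>\<^sup>+x. indicator E (X t 0 x) \<partial>\<rho>\<^sub>0) + (\<integral>\<^sup>+s\<in>{0<..t}. indicator E (X t s 0) \<partial>\<mu>)"
    if "t \<in> {0..T}" "E \<in> sets (restrict_space borel {0..<1})" for t E
    using em[OF that] flow_integrals_eq_transported[OF m \<xi>0 that(1), of E X] that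
    by (simp add: sets_restrict_space_iff X_def)
  ultimately show ?thesis
    using assms(2) W_meas unfolding lagrangian_solution_def Let_def W_def[abs_def] by blast
qed

lemma transported_measure_exists:
  assumes "mono \<xi>"
  obtains M where "M \<in> Mplus {0..<1}"
    "\<And>E. E \<in> sets (restrict_space borel {0..<1}) \<Longrightarrow> emeasure M E = transported \<xi> t E"
proof -
  let ?S = "sets (restrict_space borel {0..<1::real})"
  define M where "M = measure_of {0..<1} ?S (transported \<xi> t)"
  have sp: "space (restrict_space borel {0..<1::real}) = {0..<1}" by (simp add: space_restrict_space)
  have sa: "sigma_algebra {0..<1} ?S"
    using sets.sigma_algebra_axioms[of "restrict_space borel {0..<1::real}"] by (simp add: sp)
  have em: "emeasure M E = transported \<xi> t E" if "E \<in> ?S" for E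
    unfolding M_def
    by (rule emeasure_measure_of_sigma[OF sa _ countably_additive_transported[OF assms] that])
      (simp add: positive_def transported_def)
  have "?S \<subseteq> Pow {0..<1}" using sets.space_closed[of "restrict_space borel {0..<1::real}"] by (simp add: sp)
  then have "sets M = ?S" "space M = {0..<1}"
    using sigma_algebra.sigma_sets_eq[OF sa] by (simp_all add: M_def)
  moreover have "emeasure M {0..<1} \<noteq> \<infinity>"
    by (subst em) (auto simp: sets_restrict_space_iff transported_def \<rho>\<^sub>0.emeasure_eq_measure \<mu>.emeasure_eq_measure
        ennreal_plus[symmetric] simp del: ennreal_plus)
  ultimately have "M \<in> Mplus {0..<1}"
    by (auto simp: Mplus_def intro: finite_measureI)
  then show thesis using em by (rule that)
qed

section \<open>Existence and uniqueness of the solution\<close>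

text \<open>Uniqueness is equality of functions, so \<open>extensional\<close> fixes the values
  outside [0,T]. Inside, the front determines the measures, and the front is unique.\<close>

theorem lagrangian_solution_unique_exists:
  "\<exists>!\<rho>. \<rho> \<in> extensional {0..T} \<and> lagrangian_solution \<alpha> T \<rho>\<^sub>0 \<mu> \<rho>"
proof (rule ex_ex1I)
  obtain \<xi> where \<xi>: "front T \<xi>" by (rule front_exists)
  then have "mono \<xi>" by (simp add: front_def)
  then have "\<forall>t. \<exists>M. M \<in> Mplus {0..<1} \<and>
      (\<forall>E\<in>sets (restrict_space borel {0..<1}). emeasure M E = transported \<xi> t E)"
    by (metis transported_measure_exists)
  then obtain R where R: "\<And>t. R t \<in> Mplus {0..<1}"
    "\<And>t E. E \<in> sets (restrict_space borel {0..<1}) \<Longrightarrow> emeasure (R t) E = transported \<xi> t E"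
    by metis
  have "lagrangian_solution \<alpha> T \<rho>\<^sub>0 \<mu> (restrict R {0..T})"
    by (rule front_lagrangian_solution[OF \<xi>]) (use R in auto)
  then show "\<exists>\<rho>. \<rho> \<in> extensional {0..T} \<and> lagrangian_solution \<alpha> T \<rho>\<^sub>0 \<mu> \<rho>" by blast
next
  fix \<rho> \<rho>'
  assume \<rho>: "\<rho> \<in> extensional {0..T} \<and> lagrangian_solution \<alpha> T \<rho>\<^sub>0 \<mu> \<rho>"
    and \<rho>': "\<rho>' \<in> extensional {0..T} \<and> lagrangian_solution \<alpha> T \<rho>\<^sub>0 \<mu> \<rho>'"
  obtain \<xi> where \<xi>: "front T \<xi>"
    "\<And>t E. t \<in> {0..T} \<Longrightarrow> E \<in> sets (restrict_space borel {0..<1}) \<Longrightarrow> emeasure (\<rho> t) E = transported \<xi> t E"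
    using lagrangian_solution_front \<rho> by blast
  obtain \<xi>' where \<xi>': "front T \<xi>'"
    "\<And>t E. t \<in> {0..T} \<Longrightarrow> E \<in> sets (restrict_space borel {0..<1}) \<Longrightarrow> emeasure (\<rho>' t) E = transported \<xi>' t E"
    using lagrangian_solution_front \<rho>' by blast
  show "\<rho> = \<rho>'"
  proof (rule extensionalityI)
    fix t assume t: "t \<in> {0..T}"
    have "\<rho> t \<in> Mplus {0..<1}" "\<rho>' t \<in> Mplus {0..<1}"
      using \<rho> \<rho>' t by (auto simp: lagrangian_solution_def)
    then have sets: "sets (\<rho> t) = sets (restrict_space borel {0..<1})" "sets (\<rho>' t) = sets (restrict_space borel {0..<1})"
      by (auto simp: Mplus_def)
    show "\<rho> t = \<rho>' t"
    proof (rule measure_eqI)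
      show "sets (\<rho> t) = sets (\<rho>' t)" using sets by simp
      fix E assume E: "E \<in> sets (\<rho> t)"
      \<comment> \<open>Only \<open>\<xi> t\<close> and the values at entry times in (0,t] occur
        here, and there the two fronts agree.\<close>
      have "transported \<xi> t E = transported \<xi>' t E"
        unfolding transported_def using front_unique[OF \<xi>(1) \<xi>'(1)] t
        by (intro arg_cong2[where f = plus] arg_cong2[where f = emeasure] refl) auto
      then show "emeasure (\<rho> t) E = emeasure (\<rho>' t) E" using \<xi>(2) \<xi>'(2) t E sets by simp
    qed
  qed (use \<rho> \<rho>' in auto)
qed

end

theorem mainTheorem1:
  fixes \<alpha> :: "real \<Rightarrow> real" and T :: real and \<rho>\<^sub>0 \<mu> :: "real measure"
  assumes "\<alpha> \<in> {0..} \<rightarrow> {0<..1}"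
    and "strict_antimono_on {0..} \<alpha>"
    and "\<exists>L. L-lipschitz_on {0..} \<alpha>"
    and "\<alpha> 0 = 1"
    and "T > 0"
    and "\<rho>\<^sub>0 \<in> Mplus {0..<1}" and "zero_singular_continuous_part {0..<1} \<rho>\<^sub>0"
    and "\<mu> \<in> Mplus {0<..T}" and "zero_singular_continuous_part {0<..T} \<mu>"
  shows "\<exists>!\<rho>. \<rho> \<in> extensional {0..T} \<and> lagrangian_solution \<alpha> T \<rho>\<^sub>0 \<mu> \<rho>"
proof -
  obtain L where L: "L-lipschitz_on {0..} \<alpha>" using assms(3) by blast
  have "\<alpha> y \<le> \<alpha> x" if "0 \<le> x" "x \<le> y" for x y
    using monotone_onD[OF assms(2), of x y] that by (cases "x = y") auto
  then interpret influx_problem \<alpha> T \<rho>\<^sub>0 \<mu> L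
    using assms(1,5,6,8) L by unfold_locales auto
  show ?thesis by (rule lagrangian_solution_unique_exists)
qed

end
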